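(* Let $\mathbb{C}$ be a regular $\mathsf{Ord}$-category. Then the following statements are equivalent, and each of them is equivalent to $\mathbb{C}$ being an $\mathsf{Ord}$-Mal'tsev category: (i) for any object $X$ and any congruences $R,S\colon X\looparrowright X$ on $X$, the composite $RS$ is a congruence on $X$; (ii) $RS\cong SR$, for any object $X$ and any congruences $R,S\colon X\looparrowright X$ on $X$; (iii) $RS\cong SR$, for any object $X$ and any effective congruences $R,S\colon X\looparrowright X$ on $X$; (iv) every ideal $X\stackrel{d_1}{\longleftarrow} D \stackrel{d_2}{\longrightarrow} Y$ in $\mathbb{C}$ satisfies $DD^*D\cong D$; (v) for any object $X$, every reflexive ideal $R\colon X\looparrowright X$ on $X$ is a congruence.
   Context: An $\mathsf{Ord}$-category $\mathbb{C}$ is a category enriched in preordered sets and monotone maps: every hom-set $\mathbb{C}(X,Y)$ carries a preorder $\preccurlyeq$ (reflexive, transitive) that is preserved by composition on both sides. An ff-monomorphism is a monomorphism $m\colon X\to Y$ such that $ma\preccurlyeq ma'$ implies $a\preccurlyeq a'$ for all $a,a'\colon A\to X$. An so-morphism is a morphism left orthogonal to every ff-monomorphism (diagonal fill-in property). The comma object of $(f\colon X\to Y,\ g\colon Z\to Y)$ is an object $f/g$ with $\pi_1\colon f/g\to X$, $\pi_2\colon f/g\to Z$, $f\pi_1\preccurlyeq g\pi_2$, such that for all $\alpha\colon A\to X$, $\beta\colon A\to Z$ with $f\alpha\preccurlyeq g\beta$ there is a unique $\langle\alpha,\beta\rangle\colon A\to f/g$ with $\pi_1\langle\alpha,\beta\rangle=\alpha$,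 $\pi_2\langle\alpha,\beta\rangle=\beta$; and $\alpha\preccurlyeq\alpha'$, $\beta\preccurlyeq\beta'$ imply $\langle\alpha,\beta\rangle\preccurlyeq\langle\alpha',\beta'\rangle$. A bicoinserter of $a,b\colon X\to A$ is $e\colon A\to E$ with $ea\preccurlyeq eb$ such that: if $f\colon A\to F$ satisfies $fa\preccurlyeq fb$, there is $t\colon E\to F$ with $f\preccurlyeq te\preccurlyeq f$; and if moreover $f'a\preccurlyeq f'b$ and $f\preccurlyeq f'$, the corresponding $t,t'$ satisfy $t\preccurlyeq t'$. $\mathbb{C}$ is regular when: (R1) it has finite (weighted, $\mathsf{Ord}$-enriched) limits; (R2) it has an (so-morphism, ff-monomorphism) factorisation system; (R3) so-morphisms are stable under 2-pullbacks (i.e. $\mathsf{Ord}$-enriched pullbacks); (R4) every so-morphism is a bicoinserter of the projections of its comma object. A relation from $X$ to $Y$ is a span $X\stackrel{r_1}{\leftarrow}R\stackrel{r_2}{\to}Y$ with $(r_1,r_2)$ jointly ff-monomorphic (equivalently, when binary 2-products exist, $\langle r_1,r_2\rangle\colon R\to X\times Y$ is an ff-monomorphism). For $x\colon A\to X$, $y\colon A\to Y$, write $(x,y)\in_A R$ if there is $c\colon A\to R$ with $r_1c=x$, $r_2c=y$. $R\subseteq R'$ means that $R$ factors through $R'$ over $X\times Y$; $R\cong R'$ means $R\subseteq R'$ and $R'\subseteq R$. For relations $R$ from $X$ to $Y$ and $S$ from $Y$ to $Z$, the composite $SR$ (first $R$, then $S$) is the relation given by the (so-morphism, ff-monomorphism)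 factorisation of $\langle r_1p_1,s_2p_2\rangle\colon R\times_Y S\to X\times Z$, where $R\times_YS$ is the 2-pullback of $r_2$ and $s_1$ with projections $p_1,p_2$. A relation $R$ is an ideal, written $R\colon X\looparrowright Y$, if for all $x,x'\colon A\to X$, $y,y'\colon A\to Y$: $x'\preccurlyeq x$, $(x,y)\in_AR$ and $y\preccurlyeq y'$ imply $(x',y')\in_AR$. For a morphism $f\colon X\to Y$ put $f_*=f/1_Y\colon X\looparrowright Y$ and $f^*=1_Y/f\colon Y\looparrowright X$. For a relation $R=(r_1,r_2)$ from $X$ to $Y$ put $R^*=(r_1)_*(r_2)^*\colon Y\looparrowright X$. A relation $R$ on $X$ is reflexive if $(1_X,1_X)\in_XR$, and transitive if $RR\subseteq R$. A congruence on $X$ is a reflexive and transitive ideal $X\looparrowright X$. A congruence $R$ on $X$ is effective if $R\cong f/f$ for some morphism $f\colon X\to Y$. $\mathbb{C}$ is an $\mathsf{Ord}$-Mal'tsev category when every ideal $D\colon X\looparrowright Y$ satisfies: for all $x,u,u'\colon A\to X$ and $y,y',v\colon A\to Y$, if $(x,y)\in_AD$, $y\preccurlyeq y'$, $(u,y')\in_AD$, $u\preccurlyeq u'$ and $(u',v)\in_AD$, then $(x,v)\in_AD$. *)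

theory Defs
  imports Main
begin

section \<open>Ord-categories\<close>

text \<open>
  \<open>Le\<close> carries the preorders of all hom-sets at once; only its values on parallel arrows are
  meaningful, and it is only ever used on those.
\<close>

record ('o, 'm) ord_cat =
  Obj :: "'o set"
  Arr :: "'m set"
  Dom :: "'m \<Rightarrow> 'o"
  Cod :: "'m \<Rightarrow> 'o"
  Ide :: "'o \<Rightarrow> 'm"
  Comp :: "'m \<Rightarrow> 'm \<Rightarrow> 'm" (infixr \<open>\<cdot>\<index>\<close> 70)
  Le :: "'m \<Rightarrow> 'm \<Rightarrow> bool" (infix \<open>\<preceq>\<index>\<close> 50)

definition hom :: "('o, 'm) ord_cat \<Rightarrow> 'o \<Rightarrow> 'o \<Rightarrow> 'm set" where
  "hom C X Y = {f \<in> Arr C. Dom C f = X \<and> Cod C f = Y}"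

locale ord_category =
  fixes C :: "('o, 'm) ord_cat" (structure)
  assumes Dom_Obj: "f \<in> Arr C \<Longrightarrow> Dom C f \<in> Obj C"
    and Cod_Obj: "f \<in> Arr C \<Longrightarrow> Cod C f \<in> Obj C"
    and Ide_hom: "X \<in> Obj C \<Longrightarrow> Ide C X \<in> hom C X X"
    and Comp_hom: "\<lbrakk>f \<in> hom C X Y; g \<in> hom C Y Z\<rbrakk> \<Longrightarrow> g \<cdot> f \<in> hom C X Z"
    and Comp_Ide_right: "f \<in> hom C X Y \<Longrightarrow> f \<cdot> Ide C X = f"
    and Comp_Ide_left: "f \<in> hom C X Y \<Longrightarrow> Ide C Y \<cdot> f = f"
    and Comp_assoc: "\<lbrakk>f \<in> hom C W X; g \<in> hom C X Y; h \<in> hom C Y Z\<rbrakk>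
          \<Longrightarrow> (h \<cdot> g) \<cdot> f = h \<cdot> (g \<cdot> f)"
    and Le_refl: "f \<in> hom C X Y \<Longrightarrow> f \<preceq> f"
    and Le_trans: "\<lbrakk>f \<in> hom C X Y; g \<in> hom C X Y; h \<in> hom C X Y; f \<preceq> g; g \<preceq> h\<rbrakk> \<Longrightarrow> f \<preceq> h"
    and Le_postcomp: "\<lbrakk>f \<in> hom C X Y; f' \<in> hom C X Y; g \<in> hom C Y Z; f \<preceq> f'\<rbrakk>
          \<Longrightarrow> g \<cdot> f \<preceq> g \<cdot> f'"
    and Le_precomp: "\<lbrakk>f \<in> hom C X Y; g \<in> hom C Y Z; g' \<in> hom C Y Z; g \<preceq> g'\<rbrakk>
          \<Longrightarrow> g \<cdot> f \<preceq> g' \<cdot> f"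

section \<open>Finite weighted limits\<close>

locale ord_functor =
  J: ord_category J + C: ord_category C
  for J :: "('j, 'k) ord_cat" and C :: "('o, 'm) ord_cat" +
  fixes Do :: "'j \<Rightarrow> 'o" and Da :: "'k \<Rightarrow> 'm"
  assumes "i \<in> Obj J \<Longrightarrow> Do i \<in> Obj C"
    and "u \<in> hom J i j \<Longrightarrow> Da u \<in> hom C (Do i) (Do j)"
    and "i \<in> Obj J \<Longrightarrow> Da (Ide J i) = Ide C (Do i)"
    and "\<lbrakk>u \<in> hom J i j; v \<in> hom J j k\<rbrakk> \<Longrightarrow> Da (v \<cdot>\<^bsub>J\<^esub> u) = Da v \<cdot>\<^bsub>C\<^esub> Da u"
    and "\<lbrakk>u \<in> hom J i j; u' \<in> hom J i j; u \<preceq>\<^bsub>J\<^esub> u'\<rbrakk> \<Longrightarrow> Da u \<preceq>\<^bsub>C\<^esub> Da u'"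

text \<open>
  A weight is an \<open>Ord\<close>-functor from \<open>J\<close> to preordered sets: \<open>Ws j\<close> is the underlying set of the
  value at \<open>j\<close>, with preorder \<open>Wle j\<close>, and \<open>Wa\<close> is the action on arrows. Finiteness of the index
  category and of all values of the weight is included.
\<close>

locale finite_weight =
  J: ord_category J for J :: "('j, 'k) ord_cat" +
  fixes Ws :: "'j \<Rightarrow> 'w set" and Wle :: "'j \<Rightarrow> 'w \<Rightarrow> 'w \<Rightarrow> bool" and Wa :: "'k \<Rightarrow> 'w \<Rightarrow> 'w"
  assumes "finite (Obj J)"
    and "finite (Arr J)"
    and "j \<in> Obj J \<Longrightarrow> finite (Ws j)"
    and "\<lbrakk>j \<in> Obj J; w \<in> Ws j\<rbrakk> \<Longrightarrow> Wle j w w"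
    and "\<lbrakk>j \<in> Obj J; w \<in> Ws j; w' \<in> Ws j; w'' \<in> Ws j; Wle j w w'; Wle j w' w''\<rbrakk> \<Longrightarrow> Wle j w w''"
    and "\<lbrakk>u \<in> hom J i j; w \<in> Ws i\<rbrakk> \<Longrightarrow> Wa u w \<in> Ws j"
    and "\<lbrakk>u \<in> hom J i j; w \<in> Ws i; w' \<in> Ws i; Wle i w w'\<rbrakk> \<Longrightarrow> Wle j (Wa u w) (Wa u w')"
    and "\<lbrakk>j \<in> Obj J; w \<in> Ws j\<rbrakk> \<Longrightarrow> Wa (Ide J j) w = w"
    and "\<lbrakk>u \<in> hom J i j; v \<in> hom J j k; w \<in> Ws i\<rbrakk> \<Longrightarrow> Wa (v \<cdot>\<^bsub>J\<^esub> u) w = Wa v (Wa u w)"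
    and "\<lbrakk>u \<in> hom J i j; u' \<in> hom J i j; w \<in> Ws i; u \<preceq>\<^bsub>J\<^esub> u'\<rbrakk> \<Longrightarrow> Wle j (Wa u w) (Wa u' w)"

text \<open>
  A cone with vertex \<open>A\<close> is an \<open>Ord\<close>-natural transformation from the weight to \<open>j \<mapsto> C(A, D j)\<close>;
  its components are the arrows \<open>c j w\<close> from \<open>A\<close> to \<open>D j\<close>, for \<open>w\<close> in the weight at \<open>j\<close>.
\<close>

definition weighted_cone ::
  "('j, 'k) ord_cat \<Rightarrow> ('j \<Rightarrow> 'w set) \<Rightarrow> ('j \<Rightarrow> 'w \<Rightarrow> 'w \<Rightarrow> bool) \<Rightarrow> ('k \<Rightarrow> 'w \<Rightarrow> 'w)
    \<Rightarrow> ('o, 'm) ord_cat \<Rightarrow> ('j \<Rightarrow> 'o) \<Rightarrow> ('k \<Rightarrow> 'm) \<Rightarrow> 'o \<Rightarrow> ('j \<Rightarrow> 'w \<Rightarrow> 'm) \<Rightarrow> bool"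
where
  "weighted_cone J Ws Wle Wa C Do Da A c \<longleftrightarrow>
     (\<forall>j\<in>Obj J. \<forall>w\<in>Ws j. c j w \<in> hom C A (Do j)) \<and>
     (\<forall>j\<in>Obj J. \<forall>w\<in>Ws j. \<forall>w'\<in>Ws j. Wle j w w' \<longrightarrow> c j w \<preceq>\<^bsub>C\<^esub> c j w') \<and>
     (\<forall>i\<in>Obj J. \<forall>j\<in>Obj J. \<forall>u\<in>hom J i j. \<forall>w\<in>Ws i. Da u \<cdot>\<^bsub>C\<^esub> c i w = c j (Wa u w))"

text \<open>
  The universal property says that composition with \<open>c\<close> is an isomorphism of preordered sets from
  \<open>C(A, L)\<close> to the set of cones with vertex \<open>A\<close> (ordered componentwise), for every \<open>A\<close>.
\<close>

definition is_weighted_limit ::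
  "('j, 'k) ord_cat \<Rightarrow> ('j \<Rightarrow> 'w set) \<Rightarrow> ('j \<Rightarrow> 'w \<Rightarrow> 'w \<Rightarrow> bool) \<Rightarrow> ('k \<Rightarrow> 'w \<Rightarrow> 'w)
    \<Rightarrow> ('o, 'm) ord_cat \<Rightarrow> ('j \<Rightarrow> 'o) \<Rightarrow> ('k \<Rightarrow> 'm) \<Rightarrow> 'o \<Rightarrow> ('j \<Rightarrow> 'w \<Rightarrow> 'm) \<Rightarrow> bool"
where
  "is_weighted_limit J Ws Wle Wa C Do Da L c \<longleftrightarrow>
     L \<in> Obj C \<and> weighted_cone J Ws Wle Wa C Do Da L c \<and>
     (\<forall>A\<in>Obj C. \<forall>d. weighted_cone J Ws Wle Wa C Do Da A d \<longrightarrow>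
        (\<exists>!h\<in>hom C A L. \<forall>j\<in>Obj J. \<forall>w\<in>Ws j. c j w \<cdot>\<^bsub>C\<^esub> h = d j w)) \<and>
     (\<forall>A\<in>Obj C. \<forall>h\<in>hom C A L. \<forall>h'\<in>hom C A L.
        (\<forall>j\<in>Obj J. \<forall>w\<in>Ws j. c j w \<cdot>\<^bsub>C\<^esub> h \<preceq>\<^bsub>C\<^esub> c j w \<cdot>\<^bsub>C\<^esub> h') \<longrightarrow> h \<preceq>\<^bsub>C\<^esub> h')"

text \<open>
  Every finite \<open>Ord\<close>-category and every finite weight on it are isomorphic to ones whose objects,
  arrows and elements are natural numbers, so indexing by \<^typ>\<open>nat\<close> loses no generality.
\<close>

definition has_finite_weighted_limits :: "('o, 'm) ord_cat \<Rightarrow> bool" where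
  "has_finite_weighted_limits C \<longleftrightarrow>
     (\<forall>(J :: (nat, nat) ord_cat) (Ws :: nat \<Rightarrow> nat set) Wle Wa Do Da.
        finite_weight J Ws Wle Wa \<and> ord_functor J C Do Da \<longrightarrow>
        (\<exists>L c. is_weighted_limit J Ws Wle Wa C Do Da L c))"

definition is_product :: "('o, 'm) ord_cat \<Rightarrow> 'o \<Rightarrow> 'o \<Rightarrow> 'm \<Rightarrow> 'm \<Rightarrow> bool" where
  "is_product C X Y p q \<longleftrightarrow>
     p \<in> hom C (Dom C p) X \<and> q \<in> hom C (Dom C p) Y \<and>
     (\<forall>A\<in>Obj C. \<forall>a\<in>hom C A X. \<forall>b\<in>hom C A Y.
        \<exists>!h\<in>hom C A (Dom C p). p \<cdot>\<^bsub>C\<^esub> h = a \<and> q \<cdot>\<^bsub>C\<^esub> h = b) \<and>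
     (\<forall>A\<in>Obj C. \<forall>h\<in>hom C A (Dom C p). \<forall>h'\<in>hom C A (Dom C p).
        p \<cdot>\<^bsub>C\<^esub> h \<preceq>\<^bsub>C\<^esub> p \<cdot>\<^bsub>C\<^esub> h' \<and> q \<cdot>\<^bsub>C\<^esub> h \<preceq>\<^bsub>C\<^esub> q \<cdot>\<^bsub>C\<^esub> h' \<longrightarrow> h \<preceq>\<^bsub>C\<^esub> h')"

definition is_pullback :: "('o, 'm) ord_cat \<Rightarrow> 'm \<Rightarrow> 'm \<Rightarrow> 'm \<Rightarrow> 'm \<Rightarrow> bool" where
  "is_pullback C f g p q \<longleftrightarrow>
     f \<in> Arr C \<and> g \<in> Arr C \<and> Cod C f = Cod C g \<and>
     p \<in> hom C (Dom C p) (Dom C f) \<and> q \<in> hom C (Dom C p) (Dom C g) \<and>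
     f \<cdot>\<^bsub>C\<^esub> p = g \<cdot>\<^bsub>C\<^esub> q \<and>
     (\<forall>A\<in>Obj C. \<forall>a\<in>hom C A (Dom C f). \<forall>b\<in>hom C A (Dom C g). f \<cdot>\<^bsub>C\<^esub> a = g \<cdot>\<^bsub>C\<^esub> b \<longrightarrow>
        (\<exists>!h\<in>hom C A (Dom C p). p \<cdot>\<^bsub>C\<^esub> h = a \<and> q \<cdot>\<^bsub>C\<^esub> h = b)) \<and>
     (\<forall>A\<in>Obj C. \<forall>h\<in>hom C A (Dom C p). \<forall>h'\<in>hom C A (Dom C p).
        p \<cdot>\<^bsub>C\<^esub> h \<preceq>\<^bsub>C\<^esub> p \<cdot>\<^bsub>C\<^esub> h' \<and> q \<cdot>\<^bsub>C\<^esub> h \<preceq>\<^bsub>C\<^esub> q \<cdot>\<^bsub>C\<^esub> h' \<longrightarrow> h \<preceq>\<^bsub>C\<^esub> h')"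

definition is_comma :: "('o, 'm) ord_cat \<Rightarrow> 'm \<Rightarrow> 'm \<Rightarrow> 'm \<Rightarrow> 'm \<Rightarrow> bool" where
  "is_comma C f g p q \<longleftrightarrow>
     f \<in> Arr C \<and> g \<in> Arr C \<and> Cod C f = Cod C g \<and>
     p \<in> hom C (Dom C p) (Dom C f) \<and> q \<in> hom C (Dom C p) (Dom C g) \<and>
     f \<cdot>\<^bsub>C\<^esub> p \<preceq>\<^bsub>C\<^esub> g \<cdot>\<^bsub>C\<^esub> q \<and>
     (\<forall>A\<in>Obj C. \<forall>a\<in>hom C A (Dom C f). \<forall>b\<in>hom C A (Dom C g). f \<cdot>\<^bsub>C\<^esub> a \<preceq>\<^bsub>C\<^esub> g \<cdot>\<^bsub>C\<^esub> b \<longrightarrow>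
        (\<exists>!h\<in>hom C A (Dom C p). p \<cdot>\<^bsub>C\<^esub> h = a \<and> q \<cdot>\<^bsub>C\<^esub> h = b)) \<and>
     (\<forall>A\<in>Obj C. \<forall>h\<in>hom C A (Dom C p). \<forall>h'\<in>hom C A (Dom C p).
        p \<cdot>\<^bsub>C\<^esub> h \<preceq>\<^bsub>C\<^esub> p \<cdot>\<^bsub>C\<^esub> h' \<and> q \<cdot>\<^bsub>C\<^esub> h \<preceq>\<^bsub>C\<^esub> q \<cdot>\<^bsub>C\<^esub> h' \<longrightarrow> h \<preceq>\<^bsub>C\<^esub> h')"

section \<open>Regular Ord-categories\<close>

definition isomorphism :: "('o, 'm) ord_cat \<Rightarrow> 'm \<Rightarrow> bool" where
  "isomorphism C f \<longleftrightarrow> f \<in> Arr C \<and>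
     (\<exists>g\<in>hom C (Cod C f) (Dom C f). g \<cdot>\<^bsub>C\<^esub> f = Ide C (Dom C f) \<and> f \<cdot>\<^bsub>C\<^esub> g = Ide C (Cod C f))"

definition monomorphism :: "('o, 'm) ord_cat \<Rightarrow> 'm \<Rightarrow> bool" where
  "monomorphism C m \<longleftrightarrow> m \<in> Arr C \<and>
     (\<forall>A\<in>Obj C. \<forall>a\<in>hom C A (Dom C m). \<forall>a'\<in>hom C A (Dom C m).
        m \<cdot>\<^bsub>C\<^esub> a = m \<cdot>\<^bsub>C\<^esub> a' \<longrightarrow> a = a')"

definition ff_mono :: "('o, 'm) ord_cat \<Rightarrow> 'm \<Rightarrow> bool" where
  "ff_mono C m \<longleftrightarrow> monomorphism C m \<and>
     (\<forall>A\<in>Obj C. \<forall>a\<in>hom C A (Dom C m). \<forall>a'\<in>hom C A (Dom C m).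
        m \<cdot>\<^bsub>C\<^esub> a \<preceq>\<^bsub>C\<^esub> m \<cdot>\<^bsub>C\<^esub> a' \<longrightarrow> a \<preceq>\<^bsub>C\<^esub> a')"

definition left_orthogonal :: "('o, 'm) ord_cat \<Rightarrow> 'm \<Rightarrow> 'm \<Rightarrow> bool" where
  "left_orthogonal C e m \<longleftrightarrow>
     (\<forall>u\<in>hom C (Dom C e) (Dom C m). \<forall>v\<in>hom C (Cod C e) (Cod C m). m \<cdot>\<^bsub>C\<^esub> u = v \<cdot>\<^bsub>C\<^esub> e \<longrightarrow>
        (\<exists>!d\<in>hom C (Cod C e) (Dom C m). d \<cdot>\<^bsub>C\<^esub> e = u \<and> m \<cdot>\<^bsub>C\<^esub> d = v))"

definition so_morphism :: "('o, 'm) ord_cat \<Rightarrow> 'm \<Rightarrow> bool" where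
  "so_morphism C e \<longleftrightarrow> e \<in> Arr C \<and> (\<forall>m. ff_mono C m \<longrightarrow> left_orthogonal C e m)"

definition factorisation_system ::
  "('o, 'm) ord_cat \<Rightarrow> ('m \<Rightarrow> bool) \<Rightarrow> ('m \<Rightarrow> bool) \<Rightarrow> bool"
where
  "factorisation_system C E M \<longleftrightarrow>
     (\<forall>f. isomorphism C f \<longrightarrow> E f \<and> M f) \<and>
     (\<forall>X Y Z. \<forall>f\<in>hom C X Y. \<forall>g\<in>hom C Y Z.
        (E f \<and> E g \<longrightarrow> E (g \<cdot>\<^bsub>C\<^esub> f)) \<and> (M f \<and> M g \<longrightarrow> M (g \<cdot>\<^bsub>C\<^esub> f))) \<and>
     (\<forall>e\<in>Arr C. \<forall>m\<in>Arr C. E e \<and> M m \<longrightarrow> left_orthogonal C e m) \<and>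
     (\<forall>X Y. \<forall>f\<in>hom C X Y. \<exists>I. \<exists>e\<in>hom C X I. \<exists>m\<in>hom C I Y. E e \<and> M m \<and> f = m \<cdot>\<^bsub>C\<^esub> e)"

text \<open>
  The comparison arrow \<open>t\<close> of a bicoinserter is determined only up to the equivalence induced by
  the preorder, so the two-dimensional condition is required of every possible choice of \<open>t, t'\<close>.
\<close>

definition is_bicoinserter :: "('o, 'm) ord_cat \<Rightarrow> 'm \<Rightarrow> 'm \<Rightarrow> 'm \<Rightarrow> bool" where
  "is_bicoinserter C a b e \<longleftrightarrow>
     a \<in> Arr C \<and> b \<in> Arr C \<and> e \<in> Arr C \<and>
     Dom C a = Dom C b \<and> Cod C a = Dom C e \<and> Cod C b = Dom C e \<and>
     e \<cdot>\<^bsub>C\<^esub> a \<preceq>\<^bsub>C\<^esub> e \<cdot>\<^bsub>C\<^esub> b \<and>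
     (\<forall>F\<in>Obj C. \<forall>f\<in>hom C (Dom C e) F. f \<cdot>\<^bsub>C\<^esub> a \<preceq>\<^bsub>C\<^esub> f \<cdot>\<^bsub>C\<^esub> b \<longrightarrow>
        (\<exists>t\<in>hom C (Cod C e) F. f \<preceq>\<^bsub>C\<^esub> t \<cdot>\<^bsub>C\<^esub> e \<and> t \<cdot>\<^bsub>C\<^esub> e \<preceq>\<^bsub>C\<^esub> f)) \<and>
     (\<forall>F\<in>Obj C. \<forall>f\<in>hom C (Dom C e) F. \<forall>f'\<in>hom C (Dom C e) F.
        \<forall>t\<in>hom C (Cod C e) F. \<forall>t'\<in>hom C (Cod C e) F.
        f \<cdot>\<^bsub>C\<^esub> a \<preceq>\<^bsub>C\<^esub> f \<cdot>\<^bsub>C\<^esub> b \<and> f' \<cdot>\<^bsub>C\<^esub> a \<preceq>\<^bsub>C\<^esub> f' \<cdot>\<^bsub>C\<^esub> b \<and> f \<preceq>\<^bsub>C\<^esub> f' \<and>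
        f \<preceq>\<^bsub>C\<^esub> t \<cdot>\<^bsub>C\<^esub> e \<and> t \<cdot>\<^bsub>C\<^esub> e \<preceq>\<^bsub>C\<^esub> f \<and> f' \<preceq>\<^bsub>C\<^esub> t' \<cdot>\<^bsub>C\<^esub> e \<and> t' \<cdot>\<^bsub>C\<^esub> e \<preceq>\<^bsub>C\<^esub> f'
        \<longrightarrow> t \<preceq>\<^bsub>C\<^esub> t')"

locale regular_ord_category = ord_category C
  for C :: "('o, 'm) ord_cat" (structure) +
  assumes R1: "has_finite_weighted_limits C"
    and R2: "factorisation_system C (so_morphism C) (ff_mono C)"
    and R3: "\<lbrakk>so_morphism C e; is_pullback C g e p q\<rbrakk> \<Longrightarrow> so_morphism C p"
    and R4: "\<lbrakk>so_morphism C e; is_comma C e e p q\<rbrakk> \<Longrightarrow> is_bicoinserter C p q e"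

section \<open>Relations\<close>

text \<open>
  A span is the pair of its legs; its apex is their common domain. Comma objects and composites of
  relations, which are determined only up to isomorphism, are fixed by a choice.
\<close>

type_synonym 'm span = "'m \<times> 'm"

definition apex :: "('o, 'm) ord_cat \<Rightarrow> 'm span \<Rightarrow> 'o" where
  "apex C R = Dom C (fst R)"

definition relation :: "('o, 'm) ord_cat \<Rightarrow> 'o \<Rightarrow> 'o \<Rightarrow> 'm span \<Rightarrow> bool" where
  "relation C X Y R \<longleftrightarrow>
     fst R \<in> hom C (apex C R) X \<and> snd R \<in> hom C (apex C R) Y \<and>
     (\<forall>A\<in>Obj C. \<forall>a\<in>hom C A (apex C R). \<forall>a'\<in>hom C A (apex C R).
        fst R \<cdot>\<^bsub>C\<^esub> a = fst R \<cdot>\<^bsub>C\<^esub> a' \<and> snd R \<cdot>\<^bsub>C\<^esub> a = snd R \<cdot>\<^bsub>C\<^esub> a' \<longrightarrow> a = a') \<and>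
     (\<forall>A\<in>Obj C. \<forall>a\<in>hom C A (apex C R). \<forall>a'\<in>hom C A (apex C R).
        fst R \<cdot>\<^bsub>C\<^esub> a \<preceq>\<^bsub>C\<^esub> fst R \<cdot>\<^bsub>C\<^esub> a' \<and> snd R \<cdot>\<^bsub>C\<^esub> a \<preceq>\<^bsub>C\<^esub> snd R \<cdot>\<^bsub>C\<^esub> a' \<longrightarrow> a \<preceq>\<^bsub>C\<^esub> a')"

definition rel_mem :: "('o, 'm) ord_cat \<Rightarrow> 'o \<Rightarrow> 'm \<Rightarrow> 'm \<Rightarrow> 'm span \<Rightarrow> bool" where
  "rel_mem C A x y R \<longleftrightarrow> (\<exists>c\<in>hom C A (apex C R). fst R \<cdot>\<^bsub>C\<^esub> c = x \<and> snd R \<cdot>\<^bsub>C\<^esub> c = y)"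

definition rel_sub :: "('o, 'm) ord_cat \<Rightarrow> 'm span \<Rightarrow> 'm span \<Rightarrow> bool" where
  "rel_sub C R R' \<longleftrightarrow>
     (\<exists>c\<in>hom C (apex C R) (apex C R'). fst R' \<cdot>\<^bsub>C\<^esub> c = fst R \<and> snd R' \<cdot>\<^bsub>C\<^esub> c = snd R)"

definition rel_iso :: "('o, 'm) ord_cat \<Rightarrow> 'm span \<Rightarrow> 'm span \<Rightarrow> bool" where
  "rel_iso C R R' \<longleftrightarrow> rel_sub C R R' \<and> rel_sub C R' R"

definition is_rel_comp :: "('o, 'm) ord_cat \<Rightarrow> 'm span \<Rightarrow> 'm span \<Rightarrow> 'm span \<Rightarrow> bool" where
  "is_rel_comp C S R T \<longleftrightarrow>
     (\<exists>p1 p2 q1 q2 h e m.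
        is_pullback C (snd R) (fst S) p1 p2 \<and>
        is_product C (Cod C (fst R)) (Cod C (snd S)) q1 q2 \<and>
        h \<in> hom C (Dom C p1) (Dom C q1) \<and>
        q1 \<cdot>\<^bsub>C\<^esub> h = fst R \<cdot>\<^bsub>C\<^esub> p1 \<and> q2 \<cdot>\<^bsub>C\<^esub> h = snd S \<cdot>\<^bsub>C\<^esub> p2 \<and>
        e \<in> hom C (Dom C p1) (Dom C m) \<and> m \<in> hom C (Dom C m) (Dom C q1) \<and>
        so_morphism C e \<and> ff_mono C m \<and> h = m \<cdot>\<^bsub>C\<^esub> e \<and>
        T = (q1 \<cdot>\<^bsub>C\<^esub> m, q2 \<cdot>\<^bsub>C\<^esub> m))"

text \<open>\<open>rel_comp C S R\<close> is the composite \<open>SR\<close>: first \<open>R\<close>, then \<open>S\<close>.\<close>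

definition rel_comp :: "('o, 'm) ord_cat \<Rightarrow> 'm span \<Rightarrow> 'm span \<Rightarrow> 'm span" where
  "rel_comp C S R = (SOME T. is_rel_comp C S R T)"

definition comma :: "('o, 'm) ord_cat \<Rightarrow> 'm \<Rightarrow> 'm \<Rightarrow> 'm span" where
  "comma C f g = (SOME R. is_comma C f g (fst R) (snd R))"

definition ideal :: "('o, 'm) ord_cat \<Rightarrow> 'o \<Rightarrow> 'o \<Rightarrow> 'm span \<Rightarrow> bool" where
  "ideal C X Y R \<longleftrightarrow> relation C X Y R \<and>
     (\<forall>A\<in>Obj C. \<forall>x\<in>hom C A X. \<forall>x'\<in>hom C A X. \<forall>y\<in>hom C A Y. \<forall>y'\<in>hom C A Y.
        x' \<preceq>\<^bsub>C\<^esub> x \<and> rel_mem C A x y R \<and> y \<preceq>\<^bsub>C\<^esub> y' \<longrightarrow> rel_mem C A x' y' R)"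

definition lower_star :: "('o, 'm) ord_cat \<Rightarrow> 'm \<Rightarrow> 'm span" where
  "lower_star C f = comma C f (Ide C (Cod C f))"

definition upper_star :: "('o, 'm) ord_cat \<Rightarrow> 'm \<Rightarrow> 'm span" where
  "upper_star C f = comma C (Ide C (Cod C f)) f"

definition rel_star :: "('o, 'm) ord_cat \<Rightarrow> 'm span \<Rightarrow> 'm span" where
  "rel_star C R = rel_comp C (lower_star C (fst R)) (upper_star C (snd R))"

definition reflexive_rel :: "('o, 'm) ord_cat \<Rightarrow> 'o \<Rightarrow> 'm span \<Rightarrow> bool" where
  "reflexive_rel C X R \<longleftrightarrow> rel_mem C X (Ide C X) (Ide C X) R"

definition transitive_rel :: "('o, 'm) ord_cat \<Rightarrow> 'm span \<Rightarrow> bool" where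
  "transitive_rel C R \<longleftrightarrow> rel_sub C (rel_comp C R R) R"

definition congruence :: "('o, 'm) ord_cat \<Rightarrow> 'o \<Rightarrow> 'm span \<Rightarrow> bool" where
  "congruence C X R \<longleftrightarrow> ideal C X X R \<and> reflexive_rel C X R \<and> transitive_rel C R"

definition effective_congruence :: "('o, 'm) ord_cat \<Rightarrow> 'o \<Rightarrow> 'm span \<Rightarrow> bool" where
  "effective_congruence C X R \<longleftrightarrow> congruence C X R \<and>
     (\<exists>Y\<in>Obj C. \<exists>f\<in>hom C X Y. rel_iso C R (comma C f f))"

definition ord_maltsev :: "('o, 'm) ord_cat \<Rightarrow> bool" where
  "ord_maltsev C \<longleftrightarrow>
     (\<forall>X\<in>Obj C. \<forall>Y\<in>Obj C. \<forall>D. ideal C X Y D \<longrightarrow>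
        (\<forall>A\<in>Obj C. \<forall>x\<in>hom C A X. \<forall>u\<in>hom C A X. \<forall>u'\<in>hom C A X.
           \<forall>y\<in>hom C A Y. \<forall>y'\<in>hom C A Y. \<forall>v\<in>hom C A Y.
             rel_mem C A x y D \<and> y \<preceq>\<^bsub>C\<^esub> y' \<and> rel_mem C A u y' D \<and> u \<preceq>\<^bsub>C\<^esub> u' \<and> rel_mem C A u' v D
             \<longrightarrow> rel_mem C A x v D))"

end

theory Submission
  imports Defs
begin

text \<open>
  Membership of generalised elements behaves as for relations between sets, with one difference: a
  middle term of a composite exists only locally, that is, after precomposition with an
  so-morphism. Stability of so-morphisms provides the middle term, and orthogonality to
  ff-monomorphisms lets memberships descend along so-morphisms, so each part of the theorem can be
  argued elementwise.

  The ideal \<open>R\<^sup>*\<close> consists locally of the pairs \<open>(y, x)\<close> with \<open>y \<preceq> y'\<close> and \<open>x' \<preceq> x\<close> for some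
  \<open>(x', y')\<close> in \<open>R\<close>. Hence \<open>DD\<^sup>*D \<subseteq> D\<close> is the Mal'tsev property read through local zigzags, while
  \<open>D \<subseteq> DD\<^sup>*D\<close> always holds. The other conditions form a cycle. The Mal'tsev property makes a reflexive
  ideal transitive by inserting \<open>(y, y)\<close> between \<open>(x, y)\<close> and \<open>(y, z)\<close>. A composite \<open>RS\<close> of
  congruences is a reflexive ideal, hence then a congruence. Being transitive and containing \<open>R\<close>
  and \<open>S\<close>, it contains \<open>SR\<close>, and by symmetry congruences permute. Permutability of the two
  effective congruences \<open>d\<^sub>1/d\<^sub>1\<close> and \<open>d\<^sub>2/d\<^sub>2\<close> on the apex of an ideal \<open>D\<close> gives back the Mal'tsev
  property of \<open>D\<close>; this is the decisive step, carried by
  \<open>ord_maltsev_if_effective_congruences_permute\<close>.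
\<close>

section \<open>Composition of arrows\<close>

context ord_category
begin

text \<open>
  The axioms mention the objects between which arrows run. With domains and codomains as terms, the
  typing conditions become equations that the simplifier discharges.
\<close>

lemma Comp_Arr:
  assumes "f \<in> Arr C" "g \<in> Arr C" "Cod C f = Dom C g"
  shows "g \<cdot> f \<in> Arr C" "Dom C (g \<cdot> f) = Dom C f" "Cod C (g \<cdot> f) = Cod C g"
  using Comp_hom[of f "Dom C f" "Cod C f" g "Cod C g"] assms by (auto simp: hom_def)

lemma Comp_assoc_Arr:
  assumes "f \<in> Arr C" "g \<in> Arr C" "h \<in> Arr C" "Cod C f = Dom C g" "Cod C g = Dom C h"
  shows "(h \<cdot> g) \<cdot> f = h \<cdot> (g \<cdot> f)"
  using Comp_assoc[of f "Dom C f" "Cod C f" g "Cod C g" h "Cod C h"] assms by (auto simp: hom_def)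

lemmas arrow_simps = hom_def Comp_Arr Comp_assoc_Arr

lemma hom_Obj: "f \<in> hom C X Y \<Longrightarrow> X \<in> Obj C" "f \<in> hom C X Y \<Longrightarrow> Y \<in> Obj C"
  using Dom_Obj Cod_Obj by (auto simp: hom_def)

end

section \<open>Comma objects, pullbacks and products as weighted limits\<close>

text \<open>The free category on \<open>0 \<rightarrow> 2 \<leftarrow> 1\<close>; the arrows are the three identities, \<open>3\<close> and \<open>4\<close>.\<close>

definition cospan_shape :: "(nat, nat) ord_cat" where
  "cospan_shape = \<lparr>Obj = {0, 1, 2}, Arr = {0, 1, 2, 3, 4},
     Dom = (\<lambda>u. if u = 3 then 0 else if u = 4 then 1 else u),
     Cod = (\<lambda>u. if u = 3 \<or> u = 4 then 2 else u),
     Ide = id,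
     Comp = (\<lambda>v u. if u = 3 \<or> u = 4 then u else v),
     Le = (=)\<rparr>"

definition discrete_pair_shape :: "(nat, nat) ord_cat" where
  "discrete_pair_shape = \<lparr>Obj = {0, 1}, Arr = {0, 1}, Dom = id, Cod = id, Ide = id,
     Comp = (\<lambda>v u. v), Le = (=)\<rparr>"

lemma hom_cospan_shape_iff:
  "u \<in> hom cospan_shape i j \<longleftrightarrow>
    u = 0 \<and> i = 0 \<and> j = 0 \<or> u = 1 \<and> i = 1 \<and> j = 1 \<or> u = 2 \<and> i = 2 \<and> j = 2 \<or>
    u = 3 \<and> i = 0 \<and> j = 2 \<or> u = 4 \<and> i = 1 \<and> j = 2"
  by (auto simp: hom_def cospan_shape_def)

lemma ord_category_cospan_shape: "ord_category cospan_shape"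
  by unfold_locales (auto simp: cospan_shape_def hom_def split: if_splits)

lemma ord_category_discrete_pair_shape: "ord_category discrete_pair_shape"
  by unfold_locales (auto simp: discrete_pair_shape_def hom_def)

text \<open>
  The weight \<open>{0} \<rightarrow> {0..k} \<leftarrow> {0}\<close> picks the least and the greatest element of the chain \<open>{0..k}\<close>.
  A cone over \<open>f, g\<close> is a pair of arrows \<open>x, y\<close> together with a chain from \<open>f x\<close> to \<open>g y\<close>: for
  \<open>k = 0\<close> this says that \<open>f x\<close> and \<open>g y\<close> are equal, for \<open>k = 1\<close> that \<open>f x \<preceq> g y\<close>.
\<close>

definition cospan_weight_set :: "nat \<Rightarrow> nat \<Rightarrow> nat set" where
  "cospan_weight_set k j = (if j = 2 then {0..k} else {0})"

definition cospan_weight_arr :: "nat \<Rightarrow> nat \<Rightarrow> nat \<Rightarrow> nat" where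
  "cospan_weight_arr k u w = (if u = 4 then k else w)"

lemma finite_weight_cospan:
  "finite_weight cospan_shape (cospan_weight_set k) (\<lambda>_. (\<le>)) (cospan_weight_arr k)"
proof -
  interpret J: ord_category cospan_shape by (rule ord_category_cospan_shape)
  show ?thesis
    by unfold_locales
      (auto simp: cospan_shape_def hom_def cospan_weight_set_def cospan_weight_arr_def
        split: if_splits)
qed

lemma finite_weight_discrete_pair:
  "finite_weight discrete_pair_shape (\<lambda>_. {0}) (\<lambda>_. (=)) (\<lambda>_ w. w)"
proof -
  interpret J: ord_category discrete_pair_shape by (rule ord_category_discrete_pair_shape)
  show ?thesis
    by unfold_locales (auto simp: discrete_pair_shape_def hom_def)
qed

context ord_category
begin

lemma ord_functor_cospan:
  assumes f: "f \<in> hom C X Z" and g: "g \<in> hom C Y Z"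
  shows "ord_functor cospan_shape C (\<lambda>j. if j = 0 then X else if j = 1 then Y else Z)
    (\<lambda>u. if u = 0 then Ide C X else if u = 1 then Ide C Y else if u = 2 then Ide C Z
         else if u = 3 then f else g)"
proof -
  interpret J: ord_category cospan_shape by (rule ord_category_cospan_shape)
  note objs = hom_Obj[OF f] hom_Obj[OF g]
  note ide = Ide_hom[OF objs(1)] Ide_hom[OF objs(2)] Ide_hom[OF objs(3)]
  note units = Comp_Ide_left[OF ide(1)] Comp_Ide_left[OF ide(2)] Comp_Ide_left[OF ide(3)]
    Comp_Ide_left[OF f] Comp_Ide_left[OF g] Comp_Ide_right[OF f] Comp_Ide_right[OF g]
  note refls = Le_refl[OF ide(1)] Le_refl[OF ide(2)] Le_refl[OF ide(3)] Le_refl[OF f] Le_refl[OF g]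
  show ?thesis
    apply unfold_locales
    subgoal using objs by (auto simp: cospan_shape_def)
    subgoal using f g ide unfolding hom_cospan_shape_iff by (elim disjE) simp_all
    subgoal by (auto simp: cospan_shape_def)
    subgoal using units unfolding hom_cospan_shape_iff
      by (elim disjE) (simp_all add: cospan_shape_def)
    subgoal using refls unfolding hom_cospan_shape_iff
      by (elim disjE) (simp_all add: cospan_shape_def)
    done
qed

lemma ord_functor_discrete_pair:
  assumes X: "X \<in> Obj C" and Y: "Y \<in> Obj C"
  shows "ord_functor discrete_pair_shape C (\<lambda>j. if j = 0 then X else Y)
    (\<lambda>u. if u = 0 then Ide C X else Ide C Y)"
proof -
  interpret J: ord_category discrete_pair_shape by (rule ord_category_discrete_pair_shape)
  note ide = Ide_hom[OF X] Ide_hom[OF Y]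
  note units = Comp_Ide_left[OF ide(1)] Comp_Ide_left[OF ide(2)]
  show ?thesis
    apply unfold_locales
    subgoal using X Y by (auto simp: discrete_pair_shape_def)
    subgoal using ide by (auto simp: discrete_pair_shape_def hom_def)
    subgoal by (auto simp: discrete_pair_shape_def)
    subgoal using units by (auto simp: discrete_pair_shape_def hom_def)
    subgoal using Le_refl[OF ide(1)] Le_refl[OF ide(2)]
      by (auto simp: discrete_pair_shape_def hom_def)
    done
qed

end

context regular_ord_category
begin

text \<open>
  Pullbacks and comma objects at once: the chain in a cone over \<open>f, g\<close> has only its two ends, which
  are \<open>f x\<close> and \<open>g y\<close>, so the cone amounts to the pair \<open>x, y\<close>.
\<close>

lemma cospan_limit_exists:
  fixes k :: nat
  assumes f: "f \<in> hom C X Z" and g: "g \<in> hom C Y Z"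
    and \<Phi>: "k = 0 \<and> \<Phi> = (=) \<or> k = 1 \<and> \<Phi> = Le C"
  obtains L p q where "p \<in> hom C L X" "q \<in> hom C L Y" "\<Phi> (f \<cdot> p) (g \<cdot> q)"
    "\<forall>A. \<forall>x\<in>hom C A X. \<forall>y\<in>hom C A Y. \<Phi> (f \<cdot> x) (g \<cdot> y) \<longrightarrow>
       (\<exists>!h\<in>hom C A L. p \<cdot> h = x \<and> q \<cdot> h = y)"
    "\<forall>A. \<forall>h\<in>hom C A L. \<forall>h'\<in>hom C A L. p \<cdot> h \<preceq> p \<cdot> h' \<and> q \<cdot> h \<preceq> q \<cdot> h' \<longrightarrow> h \<preceq> h'"
proof -
  let ?Do = "\<lambda>j::nat. if j = 0 then X else if j = 1 then Y else Z"
  let ?Da = "\<lambda>u::nat. if u = 0 then Ide C X else if u = 1 then Ide C Y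
    else if u = 2 then Ide C Z else if u = 3 then f else g"
  let ?cone = "weighted_cone cospan_shape (cospan_weight_set k) (\<lambda>_. (\<le>)) (cospan_weight_arr k) C
    ?Do ?Da"
  note objs = hom_Obj[OF f] hom_Obj[OF g]
  have "\<exists>L c. is_weighted_limit cospan_shape (cospan_weight_set k) (\<lambda>_. (\<le>)) (cospan_weight_arr k) C
    ?Do ?Da L c"
    using R1 finite_weight_cospan[of k] ord_functor_cospan[OF f g]
    unfolding has_finite_weighted_limits_def by blast
  then obtain L c where
    lim: "is_weighted_limit cospan_shape (cospan_weight_set k) (\<lambda>_. (\<le>)) (cospan_weight_arr k) C
    ?Do ?Da L c" by blast
  then have cone: "?cone L c" unfolding is_weighted_limit_def by blast
  have kcases: "k = 0 \<or> k = 1" using \<Phi> by blast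
  have p: "c 0 0 \<in> hom C L X" and q: "c 1 0 \<in> hom C L Y"
    using cone unfolding weighted_cone_def by (auto simp: cospan_shape_def cospan_weight_set_def)
  have arr: "3 \<in> hom cospan_shape 0 2" "4 \<in> hom cospan_shape 1 2"
    by (auto simp: hom_def cospan_shape_def)
  have nat_eq: "?Da u \<cdot> c i w = c j (cospan_weight_arr k u w)"
    if "u \<in> hom cospan_shape i j" "w \<in> cospan_weight_set k i" "i \<in> Obj cospan_shape"
      "j \<in> Obj cospan_shape" for u i j w
    using cone that unfolding weighted_cone_def by blast
  have fp: "f \<cdot> c 0 0 = c 2 0"
    using nat_eq[OF arr(1), of 0]
    by (auto simp: cospan_shape_def cospan_weight_set_def cospan_weight_arr_def)
  have gq: "g \<cdot> c 1 0 = c 2 k"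
    using nat_eq[OF arr(2), of 0]
    by (auto simp: cospan_shape_def cospan_weight_set_def cospan_weight_arr_def)
  have mono: "c j w \<preceq> c j w'" if "j \<in> Obj cospan_shape" "w \<in> cospan_weight_set k j"
    "w' \<in> cospan_weight_set k j" "w \<le> w'" for j w w'
    using cone that unfolding weighted_cone_def by blast
  have phi: "\<Phi> (f \<cdot> c 0 0) (g \<cdot> c 1 0)"
    unfolding fp gq
    using mono[of 2 0 k] \<Phi> by (auto simp: cospan_shape_def cospan_weight_set_def)
  (* Since k is at most 1, the chain {0..k} consists of its two ends. *)
  have all_comps: "(\<forall>j\<in>Obj cospan_shape. \<forall>w\<in>cospan_weight_set k j. P j w) \<longleftrightarrow>
      P 0 0 \<and> P 1 0 \<and> P 2 0 \<and> P 2 k" for P :: "nat \<Rightarrow> nat \<Rightarrow> bool"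
    using kcases by (auto simp: cospan_shape_def cospan_weight_set_def le_Suc_eq)
  show thesis
  proof (rule that[OF p q phi]; intro allI ballI impI; (elim conjE)?)
    fix A x y assume x: "x \<in> hom C A X" and y: "y \<in> hom C A Y" and xy: "\<Phi> (f \<cdot> x) (g \<cdot> y)"
    define d where "d = (\<lambda>(j::nat) (w::nat). if j = 0 then x else if j = 1 then y
      else if w = 0 then f \<cdot> x else g \<cdot> y)"
    have A: "A \<in> Obj C" using hom_Obj[OF x] by simp
    note fx = Comp_hom[OF x f] and gy = Comp_hom[OF y g]
    have "?cone A d"
      unfolding weighted_cone_def
    proof (intro conjI ballI impI)
      fix j w assume "j \<in> Obj cospan_shape" "w \<in> cospan_weight_set k j"
      then show "d j w \<in> hom C A (?Do j)"
        using x y fx gy by (auto simp: d_def cospan_shape_def cospan_weight_set_def)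
    next
      fix j w w' assume j: "j \<in> Obj cospan_shape"
        and "w \<in> cospan_weight_set k j" "w' \<in> cospan_weight_set k j" "w \<le> w'"
      then have "w = w' \<or> j = 2 \<and> w = 0 \<and> w' = 1 \<and> k = 1"
        using kcases by (auto simp: cospan_weight_set_def split: if_splits)
      then show "d j w \<preceq> d j w'"
        using j xy \<Phi> Le_refl[OF x] Le_refl[OF y] Le_refl[OF fx] Le_refl[OF gy]
        by (elim disjE conjE) (simp_all add: d_def)
    next
      fix i j u w assume u: "u \<in> hom cospan_shape i j" and w: "w \<in> cospan_weight_set k i"
      show "?Da u \<cdot> d i w = d j (cospan_weight_arr k u w)"
        using u w xy \<Phi> Comp_Ide_left[OF x] Comp_Ide_left[OF y] Comp_Ide_left[OF fx]
          Comp_Ide_left[OF gy]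
        unfolding hom_cospan_shape_iff
        by (elim disjE conjE)
          (simp_all add: d_def cospan_weight_set_def cospan_weight_arr_def)
    qed
    then have ex: "\<exists>!h\<in>hom C A L. \<forall>j\<in>Obj cospan_shape. \<forall>w\<in>cospan_weight_set k j. c j w \<cdot> h = d j w"
      using lim A unfolding is_weighted_limit_def by blast
    have "(\<forall>j\<in>Obj cospan_shape. \<forall>w\<in>cospan_weight_set k j. c j w \<cdot> h = d j w)
        \<longleftrightarrow> c 0 0 \<cdot> h = x \<and> c 1 0 \<cdot> h = y" if h: "h \<in> hom C A L" for h
      using Comp_assoc[OF h p f] Comp_assoc[OF h q g] xy \<Phi>
      unfolding all_comps by (auto simp: d_def fp gq simp del: One_nat_def)
    then show "\<exists>!h\<in>hom C A L. c 0 0 \<cdot> h = x \<and> c 1 0 \<cdot> h = y"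
      using ex by (metis (no_types, lifting))
  next
    fix A h h' assume h: "h \<in> hom C A L" and h': "h' \<in> hom C A L"
      and le: "c 0 0 \<cdot> h \<preceq> c 0 0 \<cdot> h'" "c 1 0 \<cdot> h \<preceq> c 1 0 \<cdot> h'"
    have "c 2 0 \<cdot> h \<preceq> c 2 0 \<cdot> h'"
      using Le_postcomp[OF Comp_hom[OF h p] Comp_hom[OF h' p] f le(1)]
        Comp_assoc[OF h p f] Comp_assoc[OF h' p f] fp by simp
    moreover have "c 2 k \<cdot> h \<preceq> c 2 k \<cdot> h'"
      using Le_postcomp[OF Comp_hom[OF h q] Comp_hom[OF h' q] g le(2)]
        Comp_assoc[OF h q g] Comp_assoc[OF h' q g] gq by simp
    ultimately have
      "\<forall>j\<in>Obj cospan_shape. \<forall>w\<in>cospan_weight_set k j. c j w \<cdot> h \<preceq> c j w \<cdot> h'"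
      unfolding all_comps using le by simp
    then show "h \<preceq> h'"
      using lim h h' hom_Obj[OF h] unfolding is_weighted_limit_def by blast
  qed
qed

lemma pullback_exists:
  assumes f: "f \<in> hom C X Z" and g: "g \<in> hom C Y Z"
  obtains p q where "is_pullback C f g p q"
proof -
  obtain L p q where "p \<in> hom C L X" "q \<in> hom C L Y" "f \<cdot> p = g \<cdot> q"
    "\<forall>A. \<forall>x\<in>hom C A X. \<forall>y\<in>hom C A Y. f \<cdot> x = g \<cdot> y \<longrightarrow>
       (\<exists>!h\<in>hom C A L. p \<cdot> h = x \<and> q \<cdot> h = y)"
    "\<forall>A. \<forall>h\<in>hom C A L. \<forall>h'\<in>hom C A L. p \<cdot> h \<preceq> p \<cdot> h' \<and> q \<cdot> h \<preceq> q \<cdot> h' \<longrightarrow> h \<preceq> h'"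
    by (rule cospan_limit_exists[OF f g, of 0 "(=)"]) (simp, rule that)
  moreover have "Dom C f = X" "Dom C g = Y" "Cod C f = Cod C g" "f \<in> Arr C" "g \<in> Arr C"
    "Dom C p = L" using f g calculation by (auto simp: hom_def)
  ultimately have "is_pullback C f g p q" unfolding is_pullback_def by blast
  then show thesis by (rule that)
qed

lemma comma_exists:
  assumes f: "f \<in> hom C X Z" and g: "g \<in> hom C Y Z"
  obtains p q where "is_comma C f g p q"
proof -
  obtain L p q where "p \<in> hom C L X" "q \<in> hom C L Y" "f \<cdot> p \<preceq> g \<cdot> q"
    "\<forall>A. \<forall>x\<in>hom C A X. \<forall>y\<in>hom C A Y. f \<cdot> x \<preceq> g \<cdot> y \<longrightarrow>
       (\<exists>!h\<in>hom C A L. p \<cdot> h = x \<and> q \<cdot> h = y)"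
    "\<forall>A. \<forall>h\<in>hom C A L. \<forall>h'\<in>hom C A L. p \<cdot> h \<preceq> p \<cdot> h' \<and> q \<cdot> h \<preceq> q \<cdot> h' \<longrightarrow> h \<preceq> h'"
    by (rule cospan_limit_exists[OF f g, of 1 "Le C"]) (simp, rule that)
  moreover have "Dom C f = X" "Dom C g = Y" "Cod C f = Cod C g" "f \<in> Arr C" "g \<in> Arr C"
    "Dom C p = L" using f g calculation by (auto simp: hom_def)
  ultimately have "is_comma C f g p q" unfolding is_comma_def by blast
  then show thesis by (rule that)
qed

lemma product_exists:
  assumes X: "X \<in> Obj C" and Y: "Y \<in> Obj C"
  obtains p q where "is_product C X Y p q"
proof -
  let ?Do = "\<lambda>j::nat. if j = 0 then X else Y"
  let ?Da = "\<lambda>u::nat. if u = 0 then Ide C X else Ide C Y"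
  let ?cone = "weighted_cone discrete_pair_shape (\<lambda>_. {0::nat}) (\<lambda>_. (=)) (\<lambda>_ w. w) C ?Do ?Da"
  have "\<exists>L c. is_weighted_limit discrete_pair_shape (\<lambda>_. {0::nat}) (\<lambda>_. (=)) (\<lambda>_ w. w) C ?Do ?Da L c"
    using R1 finite_weight_discrete_pair ord_functor_discrete_pair[OF X Y]
    unfolding has_finite_weighted_limits_def by blast
  then obtain L c where
    lim: "is_weighted_limit discrete_pair_shape (\<lambda>_. {0::nat}) (\<lambda>_. (=)) (\<lambda>_ w. w) C ?Do ?Da L c"
    by blast
  have cone_iff: "?cone A d \<longleftrightarrow> d 0 0 \<in> hom C A X \<and> d 1 0 \<in> hom C A Y" for A d
    using Comp_Ide_left Le_refl
    by (auto simp: weighted_cone_def discrete_pair_shape_def hom_def)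
  have "is_product C X Y (c 0 0) (c 1 0)"
    unfolding is_product_def
  proof (intro conjI ballI impI)
    have "?cone L c" using lim unfolding is_weighted_limit_def by blast
    then have pq: "c 0 0 \<in> hom C L X" "c 1 0 \<in> hom C L Y" using cone_iff by auto
    then have L: "Dom C (c 0 0) = L" by (auto simp: hom_def)
    show "c 0 0 \<in> hom C (Dom C (c 0 0)) X" "c 1 0 \<in> hom C (Dom C (c 0 0)) Y"
      using pq L by auto
    fix A assume A: "A \<in> Obj C"
    {
      fix a b assume a: "a \<in> hom C A X" and b: "b \<in> hom C A Y"
      have "?cone A (\<lambda>j w. if j = 0 then a else b)"
        unfolding cone_iff using a b by simp
      then have "\<exists>!h\<in>hom C A L. \<forall>j\<in>Obj discrete_pair_shape. \<forall>w\<in>{0}.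
          c j w \<cdot> h = (if j = 0 then a else b)"
        using lim A unfolding is_weighted_limit_def by blast
      then show "\<exists>!h\<in>hom C A (Dom C (c 0 0)). c 0 0 \<cdot> h = a \<and> c 1 0 \<cdot> h = b"
        using L by (simp add: discrete_pair_shape_def)
    next
      fix h h' assume "h \<in> hom C A (Dom C (c 0 0))" "h' \<in> hom C A (Dom C (c 0 0))"
        "c 0 0 \<cdot> h \<preceq> c 0 0 \<cdot> h' \<and> c 1 0 \<cdot> h \<preceq> c 1 0 \<cdot> h'"
      moreover from this
      have "\<forall>j\<in>Obj discrete_pair_shape. \<forall>w\<in>{0}. c j w \<cdot> h \<preceq> c j w \<cdot> h'"
        by (auto simp: discrete_pair_shape_def)
      ultimately show "h \<preceq> h'" using lim A L unfolding is_weighted_limit_def by blast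
    }
  qed
  then show thesis by (rule that)
qed

end

section \<open>Membership in relations\<close>

text \<open>
  From here on relations are handled through their generalised elements, as if they were relations
  between sets. A relation is determined by its elements, and membership can be checked after
  precomposition with an so-morphism. Existential statements, however, hold only up to such a
  precomposition.
\<close>

lemma relation_hom:
  assumes "relation C X Y R"
  shows "fst R \<in> hom C (apex C R) X" "snd R \<in> hom C (apex C R) Y"
  using assms unfolding relation_def by auto

lemma rel_memI:
  "\<lbrakk>c \<in> hom C A (apex C R); fst R \<cdot>\<^bsub>C\<^esub> c = x; snd R \<cdot>\<^bsub>C\<^esub> c = y\<rbrakk> \<Longrightarrow> rel_mem C A x y R"
  unfolding rel_mem_def by blast

context ord_category
begin

lemma rel_mem_hom:
  assumes "relation C X Y R" "rel_mem C A x y R"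
  shows "x \<in> hom C A X" "y \<in> hom C A Y"
  using relation_hom[OF assms(1)] assms(2) Comp_hom unfolding rel_mem_def by blast+

lemma rel_mem_precomp:
  assumes R: "relation C X Y R" and xy: "rel_mem C A x y R" and b: "b \<in> hom C B A"
  shows "rel_mem C B (x \<cdot> b) (y \<cdot> b) R"
proof -
  obtain c where c: "c \<in> hom C A (apex C R)" "fst R \<cdot> c = x" "snd R \<cdot> c = y"
    using xy unfolding rel_mem_def by blast
  show ?thesis
    using Comp_assoc[OF b c(1) relation_hom(1)[OF R]] Comp_assoc[OF b c(1) relation_hom(2)[OF R]] c
    by (intro rel_memI[OF Comp_hom[OF b c(1)]]) auto
qed

lemma rel_sub_iff_legs:
  "rel_sub C R R' \<longleftrightarrow> rel_mem C (apex C R) (fst R) (snd R) R'"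
  unfolding rel_sub_def rel_mem_def by blast

lemma rel_mem_legs:
  assumes "relation C X Y R"
  shows "rel_mem C (apex C R) (fst R) (snd R) R"
  using relation_hom[OF assms] Ide_hom Comp_Ide_right hom_Obj(1)
  by (intro rel_memI[of "Ide C (apex C R)"]) auto

lemma rel_subI:
  assumes "relation C X Y R"
    and "\<And>A x y. rel_mem C A x y R \<Longrightarrow> rel_mem C A x y R'"
  shows "rel_sub C R R'"
  unfolding rel_sub_iff_legs using assms rel_mem_legs by blast

lemma rel_subD:
  assumes R': "relation C X Y R'" and sub: "rel_sub C R R'" and xy: "rel_mem C A x y R"
  shows "rel_mem C A x y R'"
proof -
  obtain c where c: "c \<in> hom C A (apex C R)" "fst R \<cdot> c = x" "snd R \<cdot> c = y"
    using xy unfolding rel_mem_def by blast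
  show ?thesis
    using rel_mem_precomp[OF R' sub[unfolded rel_sub_iff_legs] c(1)] c by simp
qed

lemma idealD:
  assumes "ideal C X Y R" "rel_mem C A x y R"
    and "x' \<in> hom C A X" "x' \<preceq> x" "y' \<in> hom C A Y" "y \<preceq> y'"
  shows "rel_mem C A x' y' R"
proof -
  have "relation C X Y R" using assms(1) unfolding ideal_def by blast
  then show ?thesis
    using assms rel_mem_hom hom_Obj(1) unfolding ideal_def by blast
qed

lemma ideal_relation: "ideal C X Y R \<Longrightarrow> relation C X Y R"
  unfolding ideal_def by blast

lemma rel_mem_reflexive:
  assumes "relation C X X R" "reflexive_rel C X R" "x \<in> hom C A X"
  shows "rel_mem C A x x R"
  using rel_mem_precomp[OF assms(1) assms(2)[unfolded reflexive_rel_def] assms(3)]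
    Comp_Ide_left[OF assms(3)] by simp

end

context regular_ord_category
begin

lemma so_ff_factorisation:
  assumes "f \<in> hom C X Y"
  obtains I e m where "e \<in> hom C X I" "m \<in> hom C I Y" "so_morphism C e" "ff_mono C m" "f = m \<cdot> e"
  using R2 assms unfolding factorisation_system_def by blast

text \<open>
  An so-morphism is orthogonal to the ff-monomorphism \<open>\<langle>r\<^sub>1, r\<^sub>2\<rangle>\<close>, so a factorisation of
  \<open>\<langle>x, y\<rangle> e\<close> through it has a diagonal.
\<close>

lemma rel_mem_descent:
  assumes R: "relation C X Y R" and e: "so_morphism C e" "e \<in> hom C B A"
    and x: "x \<in> hom C A X" and y: "y \<in> hom C A Y"
    and mem: "rel_mem C B (x \<cdot> e) (y \<cdot> e) R"
  shows "rel_mem C A x y R"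
proof -
  note r = relation_hom[OF R]
  obtain p q where pq: "is_product C X Y p q"
    using product_exists hom_Obj(2)[OF r(1)] hom_Obj(2)[OF r(2)] by blast
  let ?P = "Dom C p"
  have p: "p \<in> hom C ?P X" and q: "q \<in> hom C ?P Y"
    using pq unfolding is_product_def by auto
  have pair: "\<exists>!h\<in>hom C D ?P. p \<cdot> h = a \<and> q \<cdot> h = b" if "a \<in> hom C D X" "b \<in> hom C D Y" for D a b
    using pq that hom_Obj(1)[OF that(1)] unfolding is_product_def by blast
  obtain m where m: "m \<in> hom C (apex C R) ?P" "p \<cdot> m = fst R" "q \<cdot> m = snd R"
    using pair[OF r] by blast
  obtain v where v: "v \<in> hom C A ?P" "p \<cdot> v = x" "q \<cdot> v = y"
    using pair[OF x y] by blast
  obtain c where c: "c \<in> hom C B (apex C R)" "fst R \<cdot> c = x \<cdot> e" "snd R \<cdot> c = y \<cdot> e"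
    using mem unfolding rel_mem_def by blast
  have pm: "p \<cdot> (m \<cdot> a) = fst R \<cdot> a" "q \<cdot> (m \<cdot> a) = snd R \<cdot> a" if "a \<in> hom C D (apex C R)" for D a
    using Comp_assoc[OF that m(1) p] Comp_assoc[OF that m(1) q] m by auto
  have "ff_mono C m"
    unfolding ff_mono_def monomorphism_def
  proof (intro conjI ballI impI)
    show "m \<in> Arr C" using m by (auto simp: hom_def)
    have dom: "Dom C m = apex C R" using m by (auto simp: hom_def)
    fix D a a' assume D: "D \<in> Obj C" and "a \<in> hom C D (Dom C m)" "a' \<in> hom C D (Dom C m)"
    then have a: "a \<in> hom C D (apex C R)" "a' \<in> hom C D (apex C R)" using dom by auto
    {
      assume "m \<cdot> a = m \<cdot> a'"
      then have "fst R \<cdot> a = fst R \<cdot> a'" "snd R \<cdot> a = snd R \<cdot> a'"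
        using pm[OF a(1)] pm[OF a(2)] by auto
      then show "a = a'" using R D a unfolding relation_def by blast
    next
      assume le: "m \<cdot> a \<preceq> m \<cdot> a'"
      note ma = Comp_hom[OF a(1) m(1)] Comp_hom[OF a(2) m(1)]
      have "fst R \<cdot> a \<preceq> fst R \<cdot> a'" "snd R \<cdot> a \<preceq> snd R \<cdot> a'"
        using Le_postcomp[OF ma p le] Le_postcomp[OF ma q le] pm[OF a(1)] pm[OF a(2)] by auto
      then show "a \<preceq> a'" using R D a unfolding relation_def by blast
    }
  qed
  then have orth: "left_orthogonal C e m" using e unfolding so_morphism_def by blast
  have "m \<cdot> c = v \<cdot> e"
  proof -
    have "p \<cdot> (v \<cdot> e) = x \<cdot> e" "q \<cdot> (v \<cdot> e) = y \<cdot> e"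
      using Comp_assoc[OF e(2) v(1) p] Comp_assoc[OF e(2) v(1) q] v by auto
    moreover have "p \<cdot> (m \<cdot> c) = x \<cdot> e" "q \<cdot> (m \<cdot> c) = y \<cdot> e" using pm[OF c(1)] c by auto
    ultimately show ?thesis
      using pair[OF Comp_hom[OF e(2) x] Comp_hom[OF e(2) y]] Comp_hom[OF c(1) m(1)]
        Comp_hom[OF e(2) v(1)] by blast
  qed
  moreover have "c \<in> hom C (Dom C e) (Dom C m)" "v \<in> hom C (Cod C e) (Cod C m)"
    "hom C (Cod C e) (Dom C m) = hom C A (apex C R)"
    using c v e m by (auto simp: hom_def)
  ultimately obtain d where d: "d \<in> hom C A (apex C R)" "m \<cdot> d = v"
    using orth unfolding left_orthogonal_def by metis
  then show ?thesis
    using pm[OF d(1)] v by (intro rel_memI) auto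
qed

subsection \<open>Composites\<close>

lemma is_rel_comp_rel_comp:
  assumes R: "relation C X Y R" and S: "relation C Y Z S"
  shows "is_rel_comp C S R (rel_comp C S R)"
proof -
  note r = relation_hom[OF R] and s = relation_hom[OF S]
  have cod: "Cod C (fst R) = X" "Cod C (snd S) = Z" "Dom C (snd R) = apex C R" "Dom C (fst S) = apex C S"
    using r s by (auto simp: hom_def)
  obtain p1 p2 where p: "is_pullback C (snd R) (fst S) p1 p2"
    using pullback_exists[OF r(2) s(1)] by blast
  then have p1: "p1 \<in> hom C (Dom C p1) (apex C R)" and p2: "p2 \<in> hom C (Dom C p1) (apex C S)"
    unfolding is_pullback_def cod by auto
  obtain q1 q2 where q: "is_product C X Z q1 q2"
    using product_exists hom_Obj(2)[OF r(1)] hom_Obj(2)[OF s(2)] by blast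
  obtain h where h: "h \<in> hom C (Dom C p1) (Dom C q1)" "q1 \<cdot> h = fst R \<cdot> p1" "q2 \<cdot> h = snd S \<cdot> p2"
    using q Comp_hom[OF p1 r(1)] Comp_hom[OF p2 s(2)] hom_Obj(1)[OF p1]
    unfolding is_product_def by blast
  obtain I e m where em: "e \<in> hom C (Dom C p1) I" "m \<in> hom C I (Dom C q1)" "so_morphism C e"
    "ff_mono C m" "h = m \<cdot> e" using so_ff_factorisation[OF h(1)] by blast
  have "I = Dom C m" using em by (auto simp: hom_def)
  then have "is_rel_comp C S R (q1 \<cdot> m, q2 \<cdot> m)"
    using p q h em unfolding is_rel_comp_def cod by blast
  then show ?thesis unfolding rel_comp_def by (rule someI)
qed

lemma relation_rel_comp:
  assumes R: "relation C X Y R" and S: "relation C Y Z S"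
  shows "relation C X Z (rel_comp C S R)"
proof -
  obtain q1 q2 m where q: "is_product C (Cod C (fst R)) (Cod C (snd S)) q1 q2"
    and m: "m \<in> hom C (Dom C m) (Dom C q1)" "ff_mono C m"
    and T: "rel_comp C S R = (q1 \<cdot> m, q2 \<cdot> m)"
    using is_rel_comp_rel_comp[OF assms] unfolding is_rel_comp_def by blast
  have "Cod C (fst R) = X" "Cod C (snd S) = Z"
    using relation_hom[OF R] relation_hom[OF S] by (auto simp: hom_def)
  then have q: "is_product C X Z q1 q2" using q by simp
  then have q1: "q1 \<in> hom C (Dom C q1) X" and q2: "q2 \<in> hom C (Dom C q1) Z"
    unfolding is_product_def by auto
  have T1: "q1 \<cdot> m \<in> hom C (Dom C m) X" and T2: "q2 \<cdot> m \<in> hom C (Dom C m) Z"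
    using Comp_hom m q1 q2 by blast+
  have apex: "apex C (q1 \<cdot> m, q2 \<cdot> m) = Dom C m" using T1 by (auto simp: apex_def hom_def)
  show ?thesis
    unfolding T relation_def apex fst_conv snd_conv
  proof (intro conjI ballI impI; (elim conjE)?)
    show "q1 \<cdot> m \<in> hom C (Dom C m) X" "q2 \<cdot> m \<in> hom C (Dom C m) Z" by fact+
    fix A a a' assume A: "A \<in> Obj C" and a: "a \<in> hom C A (Dom C m)" and a': "a' \<in> hom C A (Dom C m)"
    note ma = Comp_hom[OF a m(1)] and ma' = Comp_hom[OF a' m(1)]
    note assocs = Comp_assoc[OF a m(1) q1] Comp_assoc[OF a m(1) q2]
      Comp_assoc[OF a' m(1) q1] Comp_assoc[OF a' m(1) q2]
    {
      assume eq: "(q1 \<cdot> m) \<cdot> a = (q1 \<cdot> m) \<cdot> a'" "(q2 \<cdot> m) \<cdot> a = (q2 \<cdot> m) \<cdot> a'"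
      have "m \<cdot> a = m \<cdot> a'"
      proof -
        have "\<exists>!h\<in>hom C A (Dom C q1). q1 \<cdot> h = q1 \<cdot> (m \<cdot> a) \<and> q2 \<cdot> h = q2 \<cdot> (m \<cdot> a)"
          using q A Comp_hom[OF ma q1] Comp_hom[OF ma q2] unfolding is_product_def by blast
        moreover have "q1 \<cdot> (m \<cdot> a') = q1 \<cdot> (m \<cdot> a)" "q2 \<cdot> (m \<cdot> a') = q2 \<cdot> (m \<cdot> a)"
          using eq assocs by auto
        ultimately show ?thesis using ma ma' by metis
      qed
      then show "a = a'" using m(2) A a a' unfolding ff_mono_def monomorphism_def by blast
    next
      assume "(q1 \<cdot> m) \<cdot> a \<preceq> (q1 \<cdot> m) \<cdot> a'" "(q2 \<cdot> m) \<cdot> a \<preceq> (q2 \<cdot> m) \<cdot> a'"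
      then have "m \<cdot> a \<preceq> m \<cdot> a'"
        using q A ma ma' assocs unfolding is_product_def by simp
      then show "a \<preceq> a'" using m(2) A a a' unfolding ff_mono_def by blast
    }
  qed
qed

lemma rel_mem_rel_compI:
  assumes R: "relation C X Y R" and S: "relation C Y Z S"
    and xy: "rel_mem C A x y R" and yz: "rel_mem C A y z S"
  shows "rel_mem C A x z (rel_comp C S R)"
proof -
  obtain p1 p2 q1 q2 h e m where p: "is_pullback C (snd R) (fst S) p1 p2"
    and q: "is_product C (Cod C (fst R)) (Cod C (snd S)) q1 q2"
    and h: "h \<in> hom C (Dom C p1) (Dom C q1)" "q1 \<cdot> h = fst R \<cdot> p1" "q2 \<cdot> h = snd S \<cdot> p2"
    and em: "e \<in> hom C (Dom C p1) (Dom C m)" "m \<in> hom C (Dom C m) (Dom C q1)" "h = m \<cdot> e"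
    and T: "rel_comp C S R = (q1 \<cdot> m, q2 \<cdot> m)"
    using is_rel_comp_rel_comp[OF R S] unfolding is_rel_comp_def by blast
  note r = relation_hom[OF R] and s = relation_hom[OF S]
  obtain c where c: "c \<in> hom C A (apex C R)" "fst R \<cdot> c = x" "snd R \<cdot> c = y"
    using xy unfolding rel_mem_def by blast
  obtain d where d: "d \<in> hom C A (apex C S)" "fst S \<cdot> d = y" "snd S \<cdot> d = z"
    using yz unfolding rel_mem_def by blast
  have doms: "Dom C (snd R) = apex C R" "Dom C (fst S) = apex C S"
    using r s by (auto simp: hom_def)
  then obtain k where k: "k \<in> hom C A (Dom C p1)" "p1 \<cdot> k = c" "p2 \<cdot> k = d"
    using p c d hom_Obj(1)[OF c(1)] unfolding is_pullback_def by metis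
  have homs: "p1 \<in> hom C (Dom C p1) (apex C R)" "p2 \<in> hom C (Dom C p1) (apex C S)"
    "q1 \<in> hom C (Dom C q1) X" "q2 \<in> hom C (Dom C q1) Z"
    using p q r s doms unfolding is_pullback_def is_product_def by (auto simp: hom_def)
  have ek: "e \<cdot> k \<in> hom C A (Dom C m)" using Comp_hom k em by blast
  have "(q1 \<cdot> m) \<cdot> (e \<cdot> k) = (q1 \<cdot> h) \<cdot> k" "(q2 \<cdot> m) \<cdot> (e \<cdot> k) = (q2 \<cdot> h) \<cdot> k"
    using homs em k by (simp_all add: arrow_simps)
  moreover have "(q1 \<cdot> h) \<cdot> k = x" "(q2 \<cdot> h) \<cdot> k = z"
    unfolding h using Comp_assoc[OF k(1) homs(1) r(1)] Comp_assoc[OF k(1) homs(2) s(2)] k c d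
    by simp_all
  moreover have "apex C (q1 \<cdot> m, q2 \<cdot> m) = Dom C m"
    using homs em by (simp add: apex_def arrow_simps)
  ultimately show ?thesis
    unfolding T using ek by (intro rel_memI[of "e \<cdot> k"]) auto
qed

text \<open>
  The so-part of the factorisation defining \<open>SR\<close> is pulled back along the given element. Over the
  pullback there is a middle term; stability makes the projection an so-morphism.
\<close>

lemma rel_mem_rel_compE:
  assumes R: "relation C X Y R" and S: "relation C Y Z S"
    and xz: "rel_mem C A x z (rel_comp C S R)"
  obtains B e y where "so_morphism C e" "e \<in> hom C B A"
    "rel_mem C B (x \<cdot> e) y R" "rel_mem C B y (z \<cdot> e) S"
proof -
  obtain p1 p2 q1 q2 h e m where p: "is_pullback C (snd R) (fst S) p1 p2"
    and q: "is_product C (Cod C (fst R)) (Cod C (snd S)) q1 q2"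
    and h: "h \<in> hom C (Dom C p1) (Dom C q1)" "q1 \<cdot> h = fst R \<cdot> p1" "q2 \<cdot> h = snd S \<cdot> p2"
    and em: "e \<in> hom C (Dom C p1) (Dom C m)" "m \<in> hom C (Dom C m) (Dom C q1)" "h = m \<cdot> e"
    and so: "so_morphism C e"
    and T: "rel_comp C S R = (q1 \<cdot> m, q2 \<cdot> m)"
    using is_rel_comp_rel_comp[OF R S] unfolding is_rel_comp_def by blast
  note r = relation_hom[OF R] and s = relation_hom[OF S]
  have homs: "p1 \<in> hom C (Dom C p1) (apex C R)" "p2 \<in> hom C (Dom C p1) (apex C S)"
    "q1 \<in> hom C (Dom C q1) X" "q2 \<in> hom C (Dom C q1) Z" and eq: "snd R \<cdot> p1 = fst S \<cdot> p2"
    using p q r s unfolding is_pullback_def is_product_def by (auto simp: hom_def)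
  have "apex C (q1 \<cdot> m, q2 \<cdot> m) = Dom C m"
    using homs em by (simp add: apex_def arrow_simps)
  then obtain c where c: "c \<in> hom C A (Dom C m)" "(q1 \<cdot> m) \<cdot> c = x" "(q2 \<cdot> m) \<cdot> c = z"
    using xz unfolding T rel_mem_def by auto
  obtain e' k where pb: "is_pullback C c e e' k"
    using pullback_exists[OF c(1) em(1)] by blast
  let ?B = "Dom C e'"
  have e': "e' \<in> hom C ?B A" and k: "k \<in> hom C ?B (Dom C p1)" and sq: "c \<cdot> e' = e \<cdot> k"
    using pb c em unfolding is_pullback_def by (auto simp: hom_def)
  have x: "x \<cdot> e' = fst R \<cdot> (p1 \<cdot> k)"
  proof -
    have "x \<cdot> e' = q1 \<cdot> (m \<cdot> (c \<cdot> e'))"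
      unfolding c(2)[symmetric] using homs em c(1) e' by (simp add: arrow_simps)
    also have "\<dots> = (q1 \<cdot> h) \<cdot> k"
      unfolding sq em(3) using homs em k by (simp add: arrow_simps)
    finally show ?thesis unfolding h using Comp_assoc[OF k homs(1) r(1)] by simp
  qed
  have z: "z \<cdot> e' = snd S \<cdot> (p2 \<cdot> k)"
  proof -
    have "z \<cdot> e' = q2 \<cdot> (m \<cdot> (c \<cdot> e'))"
      unfolding c(3)[symmetric] using homs em c(1) e' by (simp add: arrow_simps)
    also have "\<dots> = (q2 \<cdot> h) \<cdot> k"
      unfolding sq em(3) using homs em k by (simp add: arrow_simps)
    finally show ?thesis unfolding h using Comp_assoc[OF k homs(2) s(2)] by simp
  qed
  have y: "fst S \<cdot> (p2 \<cdot> k) = snd R \<cdot> (p1 \<cdot> k)"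
    using Comp_assoc[OF k homs(1) r(2)] Comp_assoc[OF k homs(2) s(1)] eq by simp
  show thesis
  proof (rule that[OF R3[OF so pb] e'])
    show "rel_mem C ?B (x \<cdot> e') (snd R \<cdot> (p1 \<cdot> k)) R"
      using Comp_hom[OF k homs(1)] x by (intro rel_memI) auto
    show "rel_mem C ?B (snd R \<cdot> (p1 \<cdot> k)) (z \<cdot> e') S"
      using Comp_hom[OF k homs(2)] y z by (intro rel_memI) auto
  qed
qed

text \<open>
  When the goal is itself a membership, it descends along so-morphisms, so the middle term of a
  composite may be taken at the stage \<open>B\<close> without any loss.
\<close>

lemma rel_mem_rel_comp_locally:
  assumes R: "relation C X Y R" and S: "relation C Y Z S" and Q: "relation C V W Q"
    and xz: "rel_mem C A x z (rel_comp C S R)"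
    and v: "v \<in> hom C A V" and w: "w \<in> hom C A W"
    and step: "\<And>B e y. \<lbrakk>e \<in> hom C B A; rel_mem C B (x \<cdot> e) y R; rel_mem C B y (z \<cdot> e) S\<rbrakk>
      \<Longrightarrow> rel_mem C B (v \<cdot> e) (w \<cdot> e) Q"
  shows "rel_mem C A v w Q"
proof -
  obtain B e y where e: "so_morphism C e" "e \<in> hom C B A"
    and "rel_mem C B (x \<cdot> e) y R" "rel_mem C B y (z \<cdot> e) S"
    using rel_mem_rel_compE[OF R S xz] by blast
  then show ?thesis using rel_mem_descent[OF Q e v w] step by blast
qed

lemma rel_comp_subI:
  assumes R: "relation C X Y R" and S: "relation C Y Z S" and Q: "relation C X Z Q"
    and step: "\<And>A x y z. \<lbrakk>rel_mem C A x y R; rel_mem C A y z S\<rbrakk> \<Longrightarrow> rel_mem C A x z Q"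
  shows "rel_sub C (rel_comp C S R) Q"
proof (rule rel_subI[OF relation_rel_comp[OF R S]])
  fix A x z assume xz: "rel_mem C A x z (rel_comp C S R)"
  note homs = rel_mem_hom[OF relation_rel_comp[OF R S] xz]
  show "rel_mem C A x z Q"
    by (rule rel_mem_rel_comp_locally[OF R S Q xz homs]) (rule step)
qed

lemma ideal_rel_comp:
  assumes R: "ideal C X Y R" and S: "ideal C Y Z S"
  shows "ideal C X Z (rel_comp C S R)"
proof -
  note R' = ideal_relation[OF R] and S' = ideal_relation[OF S]
  note T = relation_rel_comp[OF R' S']
  show ?thesis
    unfolding ideal_def
  proof (intro conjI ballI impI T; (elim conjE)?)
    fix A x x' z z' assume x: "x \<in> hom C A X" "x' \<in> hom C A X" and z: "z \<in> hom C A Z" "z' \<in> hom C A Z"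
      and le: "x' \<preceq> x" "z \<preceq> z'" and xz: "rel_mem C A x z (rel_comp C S R)"
    show "rel_mem C A x' z' (rel_comp C S R)"
    proof (rule rel_mem_rel_comp_locally[OF R' S' T xz x(2) z(2)])
      fix B e y assume e: "e \<in> hom C B A"
        and xy: "rel_mem C B (x \<cdot> e) y R" and yz: "rel_mem C B y (z \<cdot> e) S"
      note y = rel_mem_hom(2)[OF R' xy]
      have "rel_mem C B (x' \<cdot> e) y R"
        using idealD[OF R xy Comp_hom[OF e x(2)] Le_precomp[OF e x(2,1) le(1)] y Le_refl[OF y]] .
      moreover have "rel_mem C B y (z' \<cdot> e) S"
        using idealD[OF S yz y Le_refl[OF y] Comp_hom[OF e z(2)] Le_precomp[OF e z le(2)]] .
      ultimately show "rel_mem C B (x' \<cdot> e) (z' \<cdot> e) (rel_comp C S R)"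
        by (rule rel_mem_rel_compI[OF R' S'])
    qed
  qed
qed

lemma transitive_relD:
  assumes R: "relation C X X R" and trans: "transitive_rel C R"
    and "rel_mem C A x y R" "rel_mem C A y z R"
  shows "rel_mem C A x z R"
  using rel_subD[OF R trans[unfolded transitive_rel_def]] rel_mem_rel_compI[OF R R] assms by blast

lemma transitive_relI:
  assumes "relation C X X R"
    and "\<And>A x y z. \<lbrakk>rel_mem C A x y R; rel_mem C A y z R\<rbrakk> \<Longrightarrow> rel_mem C A x z R"
  shows "transitive_rel C R"
  unfolding transitive_rel_def using rel_comp_subI[OF assms(1,1,1)] assms(2) by blast

subsection \<open>Comma objects as ideals\<close>

lemma is_comma_comma:
  assumes "f \<in> hom C X Z" "g \<in> hom C Y Z"
  shows "is_comma C f g (fst (comma C f g)) (snd (comma C f g))"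
proof -
  obtain p q where "is_comma C f g (fst (p, q)) (snd (p, q))" using comma_exists[OF assms] by auto
  then show ?thesis unfolding comma_def by (rule someI)
qed

lemma comma_hom:
  assumes f: "f \<in> hom C X Z" and g: "g \<in> hom C Y Z"
  shows "fst (comma C f g) \<in> hom C (apex C (comma C f g)) X"
    "snd (comma C f g) \<in> hom C (apex C (comma C f g)) Y"
  using is_comma_comma[OF assms] f g unfolding is_comma_def apex_def by (auto simp: hom_def)

lemma rel_mem_comma_iff:
  assumes f: "f \<in> hom C X Z" and g: "g \<in> hom C Y Z"
    and x: "x \<in> hom C A X" and y: "y \<in> hom C A Y"
  shows "rel_mem C A x y (comma C f g) \<longleftrightarrow> f \<cdot> x \<preceq> g \<cdot> y"
proof
  let ?p = "fst (comma C f g)" and ?q = "snd (comma C f g)"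
  note pq = comma_hom[OF f g] and c = is_comma_comma[OF f g]
  have doms: "Dom C f = X" "Dom C g = Y" "A \<in> Obj C" using f g hom_Obj x by (auto simp: hom_def)
  {
    assume "rel_mem C A x y (comma C f g)"
    then obtain h where h: "h \<in> hom C A (apex C (comma C f g))" "?p \<cdot> h = x" "?q \<cdot> h = y"
      unfolding rel_mem_def by blast
    have "f \<cdot> ?p \<preceq> g \<cdot> ?q" using c unfolding is_comma_def by blast
    then show "f \<cdot> x \<preceq> g \<cdot> y"
      using Le_precomp[OF h(1) Comp_hom[OF pq(1) f] Comp_hom[OF pq(2) g]]
        Comp_assoc[OF h(1) pq(1) f] Comp_assoc[OF h(1) pq(2) g] h by simp
  next
    assume "f \<cdot> x \<preceq> g \<cdot> y"
    then show "rel_mem C A x y (comma C f g)"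
      using c x y doms unfolding is_comma_def rel_mem_def apex_def by blast
  }
qed

lemma ideal_comma:
  assumes f: "f \<in> hom C X Z" and g: "g \<in> hom C Y Z"
  shows "ideal C X Y (comma C f g)"
proof -
  let ?p = "fst (comma C f g)" and ?q = "snd (comma C f g)"
  note pq = comma_hom[OF f g] and c = is_comma_comma[OF f g]
  have doms: "Dom C f = X" "Dom C g = Y" using f g by (auto simp: hom_def)
  have rel: "relation C X Y (comma C f g)"
    unfolding relation_def
  proof (intro conjI ballI impI pq; (elim conjE)?)
    fix A a a' assume A: "A \<in> Obj C" and a: "a \<in> hom C A (apex C (comma C f g))"
      and a': "a' \<in> hom C A (apex C (comma C f g))"
    {
      assume eq: "?p \<cdot> a = ?p \<cdot> a'" "?q \<cdot> a = ?q \<cdot> a'"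
      have "rel_mem C A (?p \<cdot> a) (?q \<cdot> a) (comma C f g)" using a by (intro rel_memI) auto
      then have "f \<cdot> (?p \<cdot> a) \<preceq> g \<cdot> (?q \<cdot> a)"
        using rel_mem_comma_iff[OF f g Comp_hom[OF a pq(1)] Comp_hom[OF a pq(2)]] by simp
      then have "\<exists>!h\<in>hom C A (apex C (comma C f g)). ?p \<cdot> h = ?p \<cdot> a \<and> ?q \<cdot> h = ?q \<cdot> a"
        using c A Comp_hom[OF a pq(1)] Comp_hom[OF a pq(2)] doms
        unfolding is_comma_def apex_def by blast
      then show "a = a'" using a a' eq by metis
    next
      assume "?p \<cdot> a \<preceq> ?p \<cdot> a'" "?q \<cdot> a \<preceq> ?q \<cdot> a'"
      then show "a \<preceq> a'" using c A a a' unfolding is_comma_def apex_def by blast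
    }
  qed
  moreover have "rel_mem C A x' y' (comma C f g)"
    if x: "x \<in> hom C A X" "x' \<in> hom C A X" and y: "y \<in> hom C A Y" "y' \<in> hom C A Y"
      and le: "x' \<preceq> x" "y \<preceq> y'" and xy: "rel_mem C A x y (comma C f g)" for A x x' y y'
  proof -
    have "f \<cdot> x' \<preceq> f \<cdot> x" "f \<cdot> x \<preceq> g \<cdot> y" "g \<cdot> y \<preceq> g \<cdot> y'"
      using Le_postcomp[OF x(2,1) f le(1)] Le_postcomp[OF y g le(2)] xy
        rel_mem_comma_iff[OF f g x(1) y(1)] by auto
    then have "f \<cdot> x' \<preceq> g \<cdot> y'"
      using Le_trans Comp_hom[OF x(1) f] Comp_hom[OF x(2) f] Comp_hom[OF y(1) g] Comp_hom[OF y(2) g]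
      by blast
    then show ?thesis using rel_mem_comma_iff[OF f g x(2) y(2)] by simp
  qed
  ultimately show ?thesis unfolding ideal_def by blast
qed

lemma congruence_comma:
  assumes f: "f \<in> hom C X Y"
  shows "congruence C X (comma C f f)"
proof -
  note I = ideal_comma[OF f f] and X = hom_Obj(1)[OF f]
  note R = ideal_relation[OF I]
  have "reflexive_rel C X (comma C f f)"
    unfolding reflexive_rel_def rel_mem_comma_iff[OF f f Ide_hom[OF X] Ide_hom[OF X]]
    using Le_refl Comp_hom[OF Ide_hom[OF X] f] by blast
  moreover have "transitive_rel C (comma C f f)"
  proof (rule transitive_relI[OF R])
    fix A x y z assume xy: "rel_mem C A x y (comma C f f)" and yz: "rel_mem C A y z (comma C f f)"
    note x = rel_mem_hom(1)[OF R xy] and y = rel_mem_hom(2)[OF R xy] and z = rel_mem_hom(2)[OF R yz]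
    show "rel_mem C A x z (comma C f f)"
      using xy yz unfolding rel_mem_comma_iff[OF f f x y] rel_mem_comma_iff[OF f f y z]
        rel_mem_comma_iff[OF f f x z]
      by (rule Le_trans[OF Comp_hom[OF x f] Comp_hom[OF y f] Comp_hom[OF z f]])
  qed
  ultimately show ?thesis using I unfolding congruence_def by blast
qed

lemma effective_congruence_comma:
  assumes f: "f \<in> hom C X Y"
  shows "effective_congruence C X (comma C f f)"
proof -
  have "rel_sub C (comma C f f) (comma C f f)"
    by (rule rel_subI[OF ideal_relation[OF ideal_comma[OF f f]]])
  then show ?thesis
    using congruence_comma[OF f] f hom_Obj(2)[OF f]
    unfolding effective_congruence_def rel_iso_def by blast
qed

lemma rel_mem_lower_star_iff:
  assumes "f \<in> hom C X Y" "x \<in> hom C A X" "y \<in> hom C A Y"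
  shows "rel_mem C A x y (lower_star C f) \<longleftrightarrow> f \<cdot> x \<preceq> y"
  using rel_mem_comma_iff[OF assms(1) Ide_hom[OF hom_Obj(2)[OF assms(1)]] assms(2,3)]
    Comp_Ide_left[OF assms(3)] assms(1) unfolding lower_star_def by (simp add: hom_def)

lemma rel_mem_upper_star_iff:
  assumes "f \<in> hom C X Y" "x \<in> hom C A X" "y \<in> hom C A Y"
  shows "rel_mem C A y x (upper_star C f) \<longleftrightarrow> y \<preceq> f \<cdot> x"
  using rel_mem_comma_iff[OF Ide_hom[OF hom_Obj(2)[OF assms(1)]] assms(1) assms(3,2)]
    Comp_Ide_left[OF assms(3)] assms(1) unfolding upper_star_def by (simp add: hom_def)

lemma relation_lower_star:
  assumes "f \<in> hom C X Y"
  shows "relation C X Y (lower_star C f)"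
  using ideal_relation[OF ideal_comma[OF assms Ide_hom[OF hom_Obj(2)[OF assms]]]] assms
  unfolding lower_star_def by (simp add: hom_def)

lemma relation_upper_star:
  assumes "f \<in> hom C X Y"
  shows "relation C Y X (upper_star C f)"
  using ideal_relation[OF ideal_comma[OF Ide_hom[OF hom_Obj(2)[OF assms]] assms]] assms
  unfolding upper_star_def by (simp add: hom_def)

lemma relation_rel_star:
  assumes "relation C X Y R"
  shows "relation C Y X (rel_star C R)"
  unfolding rel_star_def using relation_hom[OF assms]
  by (intro relation_rel_comp relation_upper_star relation_lower_star)

lemma rel_mem_rel_starI:
  assumes R: "relation C X Y R" and mem: "rel_mem C A x y R"
    and y': "y' \<in> hom C A Y" "y' \<preceq> y" and x': "x' \<in> hom C A X" "x \<preceq> x'"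
  shows "rel_mem C A y' x' (rel_star C R)"
proof -
  note r = relation_hom[OF R]
  obtain c where c: "c \<in> hom C A (apex C R)" "fst R \<cdot> c = x" "snd R \<cdot> c = y"
    using mem unfolding rel_mem_def by blast
  have "rel_mem C A y' c (upper_star C (snd R))" "rel_mem C A c x' (lower_star C (fst R))"
    using rel_mem_upper_star_iff[OF r(2) c(1) y'(1)] rel_mem_lower_star_iff[OF r(1) c(1) x'(1)]
      c y' x' by auto
  then show ?thesis
    unfolding rel_star_def
    by (rule rel_mem_rel_compI[OF relation_upper_star[OF r(2)] relation_lower_star[OF r(1)]])
qed

lemma rel_mem_rel_star_locally:
  assumes R: "relation C X Y R" and Q: "relation C V W Q"
    and yx: "rel_mem C A y x (rel_star C R)"
    and v: "v \<in> hom C A V" and w: "w \<in> hom C A W"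
    and step: "\<And>B e x' y'. \<lbrakk>e \<in> hom C B A; rel_mem C B x' y' R; y \<cdot> e \<preceq> y'; x' \<preceq> x \<cdot> e\<rbrakk>
      \<Longrightarrow> rel_mem C B (v \<cdot> e) (w \<cdot> e) Q"
  shows "rel_mem C A v w Q"
proof -
  note r = relation_hom[OF R]
  note up = relation_upper_star[OF r(2)] and lo = relation_lower_star[OF r(1)]
  note xy = rel_mem_hom[OF relation_rel_star[OF R] yx]
  show ?thesis
  proof (rule rel_mem_rel_comp_locally[OF up lo Q yx[unfolded rel_star_def] v w])
    fix B e c assume e: "e \<in> hom C B A" and yc: "rel_mem C B (y \<cdot> e) c (upper_star C (snd R))"
      and cx: "rel_mem C B c (x \<cdot> e) (lower_star C (fst R))"
    note c = rel_mem_hom(2)[OF up yc]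
    have "y \<cdot> e \<preceq> snd R \<cdot> c" "fst R \<cdot> c \<preceq> x \<cdot> e"
      using yc cx rel_mem_upper_star_iff[OF r(2) c Comp_hom[OF e xy(1)]]
        rel_mem_lower_star_iff[OF r(1) c Comp_hom[OF e xy(2)]] by auto
    moreover have "rel_mem C B (fst R \<cdot> c) (snd R \<cdot> c) R" using c by (intro rel_memI) auto
    ultimately show "rel_mem C B (v \<cdot> e) (w \<cdot> e) Q" using step[OF e] by blast
  qed
qed

section \<open>The Mal'tsev property and composites of congruences\<close>

lemma ord_maltsevD:
  assumes M: "ord_maltsev C" and D: "ideal C X Y D"
    and mem: "rel_mem C A x y D" "rel_mem C A u y' D" "rel_mem C A u' v D"
    and le: "y \<preceq> y'" "u \<preceq> u'"
  shows "rel_mem C A x v D"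
proof -
  note R = ideal_relation[OF D]
  note homs = rel_mem_hom[OF R mem(1)] rel_mem_hom[OF R mem(2)] rel_mem_hom[OF R mem(3)]
  show ?thesis
    using M[unfolded ord_maltsev_def] D mem le homs hom_Obj(1)[OF homs(1)]
      hom_Obj(2)[OF homs(1)] hom_Obj(2)[OF homs(2)] by blast
qed

text \<open>
  An element of \<open>DD\<^sup>*D\<close> is locally a zigzag \<open>(x, y) \<in> D\<close>, \<open>y \<preceq> y'\<close>, \<open>(u, y') \<in> D\<close>, \<open>u \<preceq> u'\<close>,
  \<open>(u', v) \<in> D\<close>, which is the premise of the Mal'tsev property. Conversely, a single element of
  \<open>D\<close>, traversed three times, is such a zigzag.
\<close>

lemma ord_maltsev_iff_difunctional:
  "ord_maltsev C \<longleftrightarrow>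
    (\<forall>X\<in>Obj C. \<forall>Y\<in>Obj C. \<forall>D. ideal C X Y D \<longrightarrow>
       rel_iso C (rel_comp C (rel_comp C D (rel_star C D)) D) D)"
  (is "_ \<longleftrightarrow> ?iv")
proof
  assume M: "ord_maltsev C"
  show ?iv
  proof (intro ballI allI impI)
    fix X Y D assume I: "ideal C X Y D"
    note D = ideal_relation[OF I]
    note star = relation_rel_star[OF D]
    note DDs = relation_rel_comp[OF star D]
    have "rel_sub C (rel_comp C (rel_comp C D (rel_star C D)) D) D"
    proof (rule rel_comp_subI[OF D DDs D])
      fix A x y v assume xy: "rel_mem C A x y D" and yv: "rel_mem C A y v (rel_comp C D (rel_star C D))"
      note x = rel_mem_hom(1)[OF D xy] and v = rel_mem_hom(2)[OF DDs yv]
      show "rel_mem C A x v D"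
      proof (rule rel_mem_rel_comp_locally[OF star D D yv x v])
        fix B e u' assume e: "e \<in> hom C B A"
          and yu: "rel_mem C B (y \<cdot> e) u' (rel_star C D)" and uv: "rel_mem C B u' (v \<cdot> e) D"
        note xe = Comp_hom[OF e x] and ve = Comp_hom[OF e v]
        show "rel_mem C B (x \<cdot> e) (v \<cdot> e) D"
        proof (rule rel_mem_rel_star_locally[OF D D yu xe ve])
          fix B' e' u y' assume e': "e' \<in> hom C B' B" and uy: "rel_mem C B' u y' D"
            and le: "(y \<cdot> e) \<cdot> e' \<preceq> y'" "u \<preceq> u' \<cdot> e'"
          have "rel_mem C B' ((x \<cdot> e) \<cdot> e') ((y \<cdot> e) \<cdot> e') D"
            using rel_mem_precomp[OF D rel_mem_precomp[OF D xy e] e'] .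
          then show "rel_mem C B' ((x \<cdot> e) \<cdot> e') ((v \<cdot> e) \<cdot> e') D"
            using ord_maltsevD[OF M I _ uy rel_mem_precomp[OF D uv e'] le] by blast
        qed
      qed
    qed
    moreover have "rel_sub C D (rel_comp C (rel_comp C D (rel_star C D)) D)"
    proof (rule rel_subI[OF D])
      fix A x y assume xy: "rel_mem C A x y D"
      note x = rel_mem_hom(1)[OF D xy] and y = rel_mem_hom(2)[OF D xy]
      have "rel_mem C A y x (rel_star C D)"
        by (rule rel_mem_rel_starI[OF D xy y Le_refl[OF y] x Le_refl[OF x]])
      from rel_mem_rel_compI[OF star D this xy]
      show "rel_mem C A x y (rel_comp C (rel_comp C D (rel_star C D)) D)"
        by (rule rel_mem_rel_compI[OF D DDs xy])
    qed
    ultimately show "rel_iso C (rel_comp C (rel_comp C D (rel_star C D)) D) D"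
      unfolding rel_iso_def by blast
  qed
next
  assume iv: ?iv
  show "ord_maltsev C"
    unfolding ord_maltsev_def
  proof (intro ballI allI impI; elim conjE)
    fix X Y D A x u u' y y' v
    assume X: "X \<in> Obj C" and Y: "Y \<in> Obj C" and I: "ideal C X Y D"
      and y: "y \<in> hom C A Y" and u': "u' \<in> hom C A X"
      and mem: "rel_mem C A x y D" "rel_mem C A u y' D" "rel_mem C A u' v D"
      and le: "y \<preceq> y'" "u \<preceq> u'"
    note D = ideal_relation[OF I]
    note star = relation_rel_star[OF D]
    note DDs = relation_rel_comp[OF star D]
    have "rel_mem C A y u' (rel_star C D)"
      by (rule rel_mem_rel_starI[OF D mem(2) y le(1) u' le(2)])
    from rel_mem_rel_compI[OF star D this mem(3)]
    have "rel_mem C A x v (rel_comp C (rel_comp C D (rel_star C D)) D)"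
      by (rule rel_mem_rel_compI[OF D DDs mem(1)])
    moreover have "rel_sub C (rel_comp C (rel_comp C D (rel_star C D)) D) D"
      using iv X Y I unfolding rel_iso_def by blast
    ultimately show "rel_mem C A x v D" using rel_subD[OF D] by blast
  qed
qed

text \<open>
  For \<open>(x, y)\<close> and \<open>(y, z)\<close> in \<open>R\<close>, the Mal'tsev property applies to \<open>(x, y)\<close>, \<open>(y, y)\<close>, \<open>(y, z)\<close>.
\<close>

lemma reflexive_ideal_congruence_if_ord_maltsev:
  assumes M: "ord_maltsev C" and I: "ideal C X X R" and refl: "reflexive_rel C X R"
  shows "congruence C X R"
proof -
  note R = ideal_relation[OF I]
  have "transitive_rel C R"
  proof (rule transitive_relI[OF R])
    fix A x y z assume xy: "rel_mem C A x y R" and yz: "rel_mem C A y z R"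
    note y = rel_mem_hom(2)[OF R xy]
    show "rel_mem C A x z R"
      using ord_maltsevD[OF M I xy rel_mem_reflexive[OF R refl y] yz Le_refl[OF y] Le_refl[OF y]] .
  qed
  then show ?thesis using I refl unfolding congruence_def by blast
qed

lemma reflexive_rel_comp:
  assumes R: "relation C X X R" "reflexive_rel C X R" and S: "relation C X X S" "reflexive_rel C X S"
  shows "reflexive_rel C X (rel_comp C R S)"
  using rel_mem_rel_compI[OF S(1) R(1)] R(2) S(2) unfolding reflexive_rel_def by blast

text \<open>
  By reflexivity \<open>R\<close> and \<open>S\<close> are both contained in \<open>RS\<close>; if \<open>RS\<close> is transitive, it contains \<open>SR\<close>.
\<close>

lemma rel_comp_sub_swap:
  assumes R: "congruence C X R" and S: "congruence C X S" and RS: "congruence C X (rel_comp C R S)"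
  shows "rel_sub C (rel_comp C S R) (rel_comp C R S)"
proof -
  have rels: "relation C X X R" "relation C X X S" "relation C X X (rel_comp C R S)"
    using assms ideal_relation unfolding congruence_def by blast+
  have refl: "reflexive_rel C X R" "reflexive_rel C X S" and trans: "transitive_rel C (rel_comp C R S)"
    using assms unfolding congruence_def by blast+
  show ?thesis
  proof (rule rel_comp_subI[OF rels])
    fix A x y z assume xy: "rel_mem C A x y R" and yz: "rel_mem C A y z S"
    note x = rel_mem_hom(1)[OF rels(1) xy] and z = rel_mem_hom(2)[OF rels(2) yz]
    have "rel_mem C A x y (rel_comp C R S)"
      by (rule rel_mem_rel_compI[OF rels(2,1) rel_mem_reflexive[OF rels(2) refl(2) x] xy])
    moreover have "rel_mem C A y z (rel_comp C R S)"
      by (rule rel_mem_rel_compI[OF rels(2,1) yz rel_mem_reflexive[OF rels(1) refl(1) z]])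
    ultimately show "rel_mem C A x z (rel_comp C R S)"
      by (rule transitive_relD[OF rels(3) trans])
  qed
qed

text \<open>
  Given an ideal \<open>D\<close> with legs \<open>d\<^sub>1, d\<^sub>2\<close>, its elements \<open>a = (x, y)\<close>, \<open>b = (u, y')\<close>, \<open>c = (u', v)\<close>
  are arrows into the apex. There \<open>d\<^sub>2/d\<^sub>2\<close> relates \<open>a\<close> to \<open>b\<close> and \<open>d\<^sub>1/d\<^sub>1\<close> relates \<open>b\<close> to \<open>c\<close>.
  Exchanging the two gives, locally, an element \<open>w\<close> of \<open>D\<close> with \<open>d\<^sub>1 a \<preceq> d\<^sub>1 w\<close> and
  \<open>d\<^sub>2 w \<preceq> d\<^sub>2 c\<close>, so that \<open>(x, v) \<in> D\<close> because \<open>D\<close> is an ideal.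
\<close>

lemma ord_maltsev_if_effective_congruences_permute:
  assumes iii: "\<And>X R S. \<lbrakk>X \<in> Obj C; effective_congruence C X R; effective_congruence C X S\<rbrakk>
      \<Longrightarrow> rel_iso C (rel_comp C R S) (rel_comp C S R)"
  shows "ord_maltsev C"
  unfolding ord_maltsev_def
proof (intro ballI allI impI; elim conjE)
  fix X Y D A x u u' y y' v
  assume I: "ideal C X Y D" and x: "x \<in> hom C A X" and v: "v \<in> hom C A Y"
    and mem: "rel_mem C A x y D" "rel_mem C A u y' D" "rel_mem C A u' v D"
    and le: "y \<preceq> y'" "u \<preceq> u'"
  note D = ideal_relation[OF I]
  note d = relation_hom[OF D]
  define P where "P = apex C D"
  define R S where "R = comma C (fst D) (fst D)" and "S = comma C (snd D) (snd D)"
  have d1: "fst D \<in> hom C P X" and d2: "snd D \<in> hom C P Y" using d unfolding P_def by auto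
  have R: "relation C P P R" and S: "relation C P P S"
    using ideal_relation ideal_comma d1 d2 unfolding R_def S_def by blast+
  have memR: "rel_mem C B a b R \<longleftrightarrow> fst D \<cdot> a \<preceq> fst D \<cdot> b"
    and memS: "rel_mem C B a b S \<longleftrightarrow> snd D \<cdot> a \<preceq> snd D \<cdot> b"
    if "a \<in> hom C B P" "b \<in> hom C B P" for B a b
    using rel_mem_comma_iff[OF d1 d1 that] rel_mem_comma_iff[OF d2 d2 that]
    unfolding R_def S_def by auto
  obtain a where a: "a \<in> hom C A P" "fst D \<cdot> a = x" "snd D \<cdot> a = y"
    using mem(1) unfolding rel_mem_def P_def by blast
  obtain b where b: "b \<in> hom C A P" "fst D \<cdot> b = u" "snd D \<cdot> b = y'"
    using mem(2) unfolding rel_mem_def P_def by blast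
  obtain c where c: "c \<in> hom C A P" "fst D \<cdot> c = u'" "snd D \<cdot> c = v"
    using mem(3) unfolding rel_mem_def P_def by blast
  have "rel_mem C A a b S" "rel_mem C A b c R"
    using memS[OF a(1) b(1)] memR[OF b(1) c(1)] a b c le by auto
  then have "rel_mem C A a c (rel_comp C R S)"
    by (rule rel_mem_rel_compI[OF S R])
  moreover have "rel_sub C (rel_comp C R S) (rel_comp C S R)"
    using iii[OF hom_Obj(2)[OF a(1)]] effective_congruence_comma[OF d1]
      effective_congruence_comma[OF d2] unfolding R_def S_def rel_iso_def by blast
  ultimately have ac: "rel_mem C A a c (rel_comp C S R)"
    using rel_subD[OF relation_rel_comp[OF R S]] by blast
  show "rel_mem C A x v D"
  proof (rule rel_mem_rel_comp_locally[OF R S D ac x v])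
    fix B e w assume e: "e \<in> hom C B A" and aw: "rel_mem C B (a \<cdot> e) w R" and wc: "rel_mem C B w (c \<cdot> e) S"
    note w = rel_mem_hom(2)[OF R aw]
    have "x \<cdot> e \<preceq> fst D \<cdot> w" "snd D \<cdot> w \<preceq> v \<cdot> e"
      using aw wc memR[OF Comp_hom[OF e a(1)] w] memS[OF w Comp_hom[OF e c(1)]]
        Comp_assoc[OF e a(1) d1] Comp_assoc[OF e c(1) d2] a c by auto
    moreover have "rel_mem C B (fst D \<cdot> w) (snd D \<cdot> w) D"
      using w unfolding P_def by (intro rel_memI) auto
    ultimately show "rel_mem C B (x \<cdot> e) (v \<cdot> e) D"
      using idealD[OF I] Comp_hom[OF e x] Comp_hom[OF e v] by blast
  qed
qed

end

theorem theorem5p9: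
  fixes C :: "('o, 'm) ord_cat"
  assumes "regular_ord_category C"
  shows "(ord_maltsev C \<longleftrightarrow>
      (\<forall>X\<in>Obj C. \<forall>R S. congruence C X R \<and> congruence C X S \<longrightarrow> congruence C X (rel_comp C R S)))
    \<and> (ord_maltsev C \<longleftrightarrow>
      (\<forall>X\<in>Obj C. \<forall>R S. congruence C X R \<and> congruence C X S \<longrightarrow>
         rel_iso C (rel_comp C R S) (rel_comp C S R)))
    \<and> (ord_maltsev C \<longleftrightarrow>
      (\<forall>X\<in>Obj C. \<forall>R S. effective_congruence C X R \<and> effective_congruence C X S \<longrightarrow>
         rel_iso C (rel_comp C R S) (rel_comp C S R)))
    \<and> (ord_maltsev C \<longleftrightarrow>
      (\<forall>X\<in>Obj C. \<forall>Y\<in>Obj C. \<forall>D. ideal C X Y D \<longrightarrow>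
         rel_iso C (rel_comp C (rel_comp C D (rel_star C D)) D) D))
    \<and> (ord_maltsev C \<longleftrightarrow>
      (\<forall>X\<in>Obj C. \<forall>R. ideal C X X R \<and> reflexive_rel C X R \<longrightarrow> congruence C X R))"
  (is "(?M \<longleftrightarrow> ?i) \<and> (?M \<longleftrightarrow> ?ii) \<and> (?M \<longleftrightarrow> ?iii) \<and> (?M \<longleftrightarrow> ?iv) \<and> (?M \<longleftrightarrow> ?v)")
proof -
  interpret regular_ord_category C by (rule assms)
  have "?M \<Longrightarrow> ?v"
    using reflexive_ideal_congruence_if_ord_maltsev by blast
  moreover have ?i if ?v
  proof (intro ballI allI impI; elim conjE)
    fix X R S assume X: "X \<in> Obj C" and R: "congruence C X R" and S: "congruence C X S"
    have "ideal C X X (rel_comp C R S)" "reflexive_rel C X (rel_comp C R S)"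
      using R S ideal_rel_comp reflexive_rel_comp ideal_relation unfolding congruence_def by blast+
    then show "congruence C X (rel_comp C R S)" using \<open>?v\<close> X by blast
  qed
  moreover have "?i \<Longrightarrow> ?ii"
    using rel_comp_sub_swap unfolding rel_iso_def by blast
  moreover have "?ii \<Longrightarrow> ?iii"
    unfolding effective_congruence_def by blast
  moreover have "?iii \<Longrightarrow> ?M"
    using ord_maltsev_if_effective_congruences_permute by blast
  moreover have "?M \<longleftrightarrow> ?iv"
    by (rule ord_maltsev_iff_difunctional)
  ultimately show ?thesis by argo
qed

end
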